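(* Let $b$ be a regular Laurent polynomial. Then there is a constant $C(b)>0$, depending only on $b$, such that $$\|(T_b-w)^{-1}\|\le \frac{C(b)}{\operatorname{dist}(w,\sigma(T_b))}\qquad\text{for all } w\in\rho(T_b).$$ In particular, this holds whenever $b$ is an LJ-polynomial.
   Context: Notation: $\mathbb{T}=\{z\in\mathbb{C}:|z|=1\}$. A Laurent polynomial is a function $b(z)=\sum_{j=-m}^{k}b_jz^j$ with $m,k\in\mathbb{N}$ (so $m,k\ge 1$), $b_j\in\mathbb{C}$, and $b_{-m}b_k\neq0$. Toeplitz operator: $T_b$ acts on the Hardy space $H^2(\mathbb{T})$ by $T_bf=P_+(bf)$, where $P_+$ is the orthogonal projection of $L^2(\mathbb{T})$ onto $H^2(\mathbb{T})$; equivalently, $T_b$ is the operator on $\ell^2(\mathbb{N})$ with matrix $(b_{i-j})_{i,j\ge1}$, where $b_n$ are the Fourier coefficients of $b$. Here $\sigma(T_b)$ is the spectrum, $\rho(T_b)=\mathbb{C}\setminus\sigma(T_b)$ the resolvent set, and $\|\cdot\|$ the operator norm. LJ-polynomial (Laurent polynomial with the Jordan property): a Laurent polynomial $b$ such that the closed curve $b(\mathbb{T})$ is a Jordan curve (no self-intersections, i.e. $t\mapsto b(t)$ is injective on $\mathbb{T}$) and $b'(t)\ne0$ for all $t\in\mathbb{T}$. Regular Laurent polynomial: let $\Omega(b)$ be the set of $w\in\mathbb{C}\setminus b(\mathbb{T})$ such that the winding number of the closed curve $t\mapsto b(t)$, $t\in\mathbb{T}$, around $w$ is zero. For $w\in\mathbb{C}$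 let $Z(w)$ be the multiset of the $m+k$ roots (with multiplicity) of the polynomial $P(z,w)=z^m(b(z)-w)$ in $z$, and let $Z_{in}(w)$ and $Z_{ext}(w)$ be the parts of $Z(w)$ in $\{|z|<1\}$ and $\{|z|>1\}$, respectively. The Laurent polynomial $b$ is regular if at least one of the following holds: there is $r(b)\in(0,1)$ such that $Z_{in}(w)\subset\{|z|\le r(b)\}$ for all $w\in\Omega(b)$; or there is $R(b)>1$ such that $Z_{ext}(w)\subset\{|z|\ge R(b)\}$ for all $w\in\Omega(b)$. *)

theory Defs
  imports "HOL-Complex_Analysis.Complex_Analysis"
    "HOL-Computational_Algebra.Polynomial"
begin

definition square_summable :: "(nat \<Rightarrow> complex) \<Rightarrow> bool" where
  "square_summable x \<longleftrightarrow> summable (\<lambda>n. (cmod (x n))\<^sup>2)"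

lemma square_summable_zero: "square_summable (\<lambda>n. 0)"
  by (simp add: square_summable_def)

lemma square_summable_mult:
  assumes "square_summable x"
  shows "square_summable (\<lambda>n. c * x n)"
  using summable_mult[of _ "(cmod c)\<^sup>2"] assms
  by (simp add: square_summable_def norm_mult power_mult_distrib)

lemma square_summable_add:
  assumes "square_summable x" "square_summable y"
  shows "square_summable (\<lambda>n. x n + y n)"
proof -
  have "(cmod (u + v))\<^sup>2 \<le> 2 * (cmod u)\<^sup>2 + 2 * (cmod v)\<^sup>2" for u v
  proof -
    have "(cmod (u + v))\<^sup>2 \<le> (cmod u + cmod v)\<^sup>2"
      by (intro power_mono norm_triangle_ineq) auto
    also have "\<dots> \<le> 2 * (cmod u)\<^sup>2 + 2 * (cmod v)\<^sup>2"
      using sum_squares_bound[of "cmod u" "cmod v"] by (simp add: power2_sum)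
    finally show ?thesis .
  qed
  hence le: "norm ((cmod (x n + y n))\<^sup>2) \<le> 2 * (cmod (x n))\<^sup>2 + 2 * (cmod (y n))\<^sup>2" for n
    by simp
  have s: "summable (\<lambda>n. 2 * (cmod (x n))\<^sup>2 + 2 * (cmod (y n))\<^sup>2)"
    using assms by (intro summable_add summable_mult) (auto simp: square_summable_def)
  show ?thesis
    unfolding square_summable_def
    by (rule summable_comparison_test'[where N = 0, OF s]) (rule le)
qed

lemma square_summable_sum:
  assumes "\<And>j. j \<in> A \<Longrightarrow> square_summable (f j)"
  shows "square_summable (\<lambda>n. \<Sum>j\<in>A. f j n)"
  using assms
  by (induction A rule: infinite_finite_induct)
     (auto intro: square_summable_zero square_summable_add)

lemma square_summable_inner:
  assumes "square_summable x" "square_summable y"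
  shows "summable (\<lambda>n. x n \<bullet> y n)"
proof -
  have le: "norm (u \<bullet> v) \<le> (cmod u)\<^sup>2 + (cmod v)\<^sup>2" for u v :: complex
  proof -
    have "norm (u \<bullet> v) \<le> cmod u * cmod v"
      using Cauchy_Schwarz_ineq2[of u v] by simp
    moreover have "2 * (cmod u * cmod v) \<le> (cmod u)\<^sup>2 + (cmod v)\<^sup>2"
      using sum_squares_bound[of "cmod u" "cmod v"] by (simp add: mult.assoc)
    moreover have "0 \<le> cmod u * cmod v"
      by simp
    ultimately show ?thesis
      by linarith
  qed
  have s: "summable (\<lambda>n. (cmod (x n))\<^sup>2 + (cmod (y n))\<^sup>2)"
    using assms by (intro summable_add) (auto simp: square_summable_def)
  show ?thesis
    by (rule summable_comparison_test'[where N = 0, OF s]) (rule le)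
qed

typedef ell2 = "{x. square_summable x}"
  by (intro exI[of _ "\<lambda>n. 0"]) (simp add: square_summable_zero)

lemma square_summable_Rep: "square_summable (Rep_ell2 x)"
  using Rep_ell2 by simp

lemma Rep_Abs_ell2: "square_summable x \<Longrightarrow> Rep_ell2 (Abs_ell2 x) = x"
  by (simp add: Abs_ell2_inverse)

instantiation ell2 :: real_vector
begin

definition zero_ell2 :: ell2 where
  "0 = Abs_ell2 (\<lambda>n. 0)"

definition plus_ell2 :: "ell2 \<Rightarrow> ell2 \<Rightarrow> ell2" where
  "x + y = Abs_ell2 (\<lambda>n. Rep_ell2 x n + Rep_ell2 y n)"

definition minus_ell2 :: "ell2 \<Rightarrow> ell2 \<Rightarrow> ell2" where
  "x - y = Abs_ell2 (\<lambda>n. Rep_ell2 x n - Rep_ell2 y n)"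

definition uminus_ell2 :: "ell2 \<Rightarrow> ell2" where
  "- x = Abs_ell2 (\<lambda>n. - Rep_ell2 x n)"

definition scaleR_ell2 :: "real \<Rightarrow> ell2 \<Rightarrow> ell2" where
  "r *\<^sub>R x = Abs_ell2 (\<lambda>n. r *\<^sub>R Rep_ell2 x n)"

lemma Rep_zero_ell2: "Rep_ell2 0 = (\<lambda>n. 0)"
  by (simp add: zero_ell2_def Rep_Abs_ell2 square_summable_zero)

lemma Rep_plus_ell2: "Rep_ell2 (x + y) = (\<lambda>n. Rep_ell2 x n + Rep_ell2 y n)"
  by (simp add: plus_ell2_def Rep_Abs_ell2 square_summable_add square_summable_Rep)

lemma Rep_uminus_ell2: "Rep_ell2 (- x) = (\<lambda>n. - Rep_ell2 x n)"
  using square_summable_mult[OF square_summable_Rep, of "-1" x]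
  by (simp add: uminus_ell2_def Rep_Abs_ell2)

lemma Rep_minus_ell2: "Rep_ell2 (x - y) = (\<lambda>n. Rep_ell2 x n - Rep_ell2 y n)"
  using square_summable_add[OF square_summable_Rep[of x] square_summable_Rep[of "- y"]]
  by (simp add: minus_ell2_def Rep_Abs_ell2 Rep_uminus_ell2)

lemma Rep_scaleR_ell2: "Rep_ell2 (r *\<^sub>R x) = (\<lambda>n. r *\<^sub>R Rep_ell2 x n)"
  using square_summable_mult[OF square_summable_Rep, of "of_real r" x]
  by (simp add: scaleR_ell2_def Rep_Abs_ell2 scaleR_conv_of_real)

lemmas Rep_ell2_simps =
  Rep_zero_ell2 Rep_plus_ell2 Rep_uminus_ell2 Rep_minus_ell2 Rep_scaleR_ell2

instance
proof
  fix x y z :: ell2 and r s :: real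
  show "x + y + z = x + (y + z)" "x + y = y + x" "0 + x = x" "- x + x = 0" "x - y = x + - y"
    "r *\<^sub>R (x + y) = r *\<^sub>R x + r *\<^sub>R y" "(r + s) *\<^sub>R x = r *\<^sub>R x + s *\<^sub>R x"
    "r *\<^sub>R s *\<^sub>R x = (r * s) *\<^sub>R x" "1 *\<^sub>R x = x"
    by (simp_all add: Rep_ell2_inject[symmetric] Rep_ell2_simps algebra_simps)
qed

end

text \<open>
  The library has no class of complex inner product spaces.  As in its treatment of the type
  \<^typ>\<open>complex\<close>, the class instance uses the real part of the Hermitian inner product,
  which gives the usual norm; multiplication by complex scalars is introduced separately.
\<close>

instantiation ell2 :: real_inner
begin

definition inner_ell2 :: "ell2 \<Rightarrow> ell2 \<Rightarrow> real" where
  "x \<bullet> y = (\<Sum>n. Rep_ell2 x n \<bullet> Rep_ell2 y n)"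

definition norm_ell2 :: "ell2 \<Rightarrow> real" where
  "norm x = sqrt (\<Sum>n. (cmod (Rep_ell2 x n))\<^sup>2)"

definition sgn_ell2 :: "ell2 \<Rightarrow> ell2" where
  "sgn (x :: ell2) = x /\<^sub>R norm x"

definition dist_ell2 :: "ell2 \<Rightarrow> ell2 \<Rightarrow> real" where
  "dist (x :: ell2) y = norm (x - y)"

definition uniformity_ell2 :: "(ell2 \<times> ell2) filter" where
  "uniformity = (INF e\<in>{0<..}. principal {(x :: ell2, y). dist x y < e})"

definition open_ell2 :: "ell2 set \<Rightarrow> bool" where
  "open (U :: ell2 set) \<longleftrightarrow> (\<forall>x\<in>U. \<forall>\<^sub>F (x', y) in uniformity. x' = x \<longrightarrow> y \<in> U)"

instance
proof
  fix x y z :: ell2 and r s :: real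
  have summ: "summable (\<lambda>n. Rep_ell2 u n \<bullet> Rep_ell2 v n)" for u v
    by (intro square_summable_inner square_summable_Rep)
  show "dist x y = norm (x - y)" by (rule dist_ell2_def)
  show "sgn (x :: ell2) = x /\<^sub>R norm x" by (rule sgn_ell2_def)
  show "uniformity = (INF e\<in>{0<..}. principal {(x, y). dist (x::ell2) y < e})"
    by (rule uniformity_ell2_def)
  show "open U \<longleftrightarrow> (\<forall>x\<in>U. \<forall>\<^sub>F (x', y) in uniformity. x' = x \<longrightarrow> y \<in> U)" for U :: "ell2 set"
    by (rule open_ell2_def)
  show "x \<bullet> y = y \<bullet> x" by (simp add: inner_ell2_def inner_commute)
  show "(x + y) \<bullet> z = x \<bullet> z + y \<bullet> z"
    by (simp add: inner_ell2_def Rep_ell2_simps inner_add_left suminf_add[OF summ summ])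
  show "r *\<^sub>R x \<bullet> y = r * (x \<bullet> y)"
    by (simp add: inner_ell2_def Rep_ell2_simps suminf_mult[OF summ])
  show "0 \<le> x \<bullet> x"
    unfolding inner_ell2_def by (intro suminf_nonneg summ) auto
  have "(\<forall>n. Rep_ell2 x n \<bullet> Rep_ell2 x n = 0) \<longleftrightarrow> x \<bullet> x = 0"
    unfolding inner_ell2_def by (subst suminf_eq_zero_iff[OF summ]) auto
  thus "x \<bullet> x = 0 \<longleftrightarrow> x = 0"
    by (simp add: Rep_ell2_inject[symmetric] Rep_zero_ell2 fun_eq_iff)
  show "norm x = sqrt (x \<bullet> x)"
    by (simp add: norm_ell2_def inner_ell2_def power2_norm_eq_inner)
qed

end

definition scaleC_ell2 :: "complex \<Rightarrow> ell2 \<Rightarrow> ell2" where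
  "scaleC_ell2 c x = Abs_ell2 (\<lambda>n. c * Rep_ell2 x n)"

lemma Rep_scaleC_ell2: "Rep_ell2 (scaleC_ell2 c x) = (\<lambda>n. c * Rep_ell2 x n)"
  by (simp add: scaleC_ell2_def Rep_Abs_ell2 square_summable_mult square_summable_Rep)

definition shifted_op :: "(ell2 \<Rightarrow> ell2) \<Rightarrow> complex \<Rightarrow> ell2 \<Rightarrow> ell2" where
  "shifted_op T w = (\<lambda>x. T x - scaleC_ell2 w x)"

text \<open>
  For a complex-linear \<open>T\<close>, any two-sided inverse of \<open>T - w\<close> is automatically
  complex-linear, so real linearity of the inverse in \<^const>\<open>bounded_linear\<close> suffices.
\<close>

definition spectrum :: "(ell2 \<Rightarrow> ell2) \<Rightarrow> complex set" where
  "spectrum T = {w. \<not> (\<exists>S. bounded_linear S \<and> S \<circ> shifted_op T w = id \<and> shifted_op T w \<circ> S = id)}"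

definition resolvent_set :: "(ell2 \<Rightarrow> ell2) \<Rightarrow> complex set" where
  "resolvent_set T = - spectrum T"

definition resolvent :: "(ell2 \<Rightarrow> ell2) \<Rightarrow> complex \<Rightarrow> ell2 \<Rightarrow> ell2" where
  "resolvent T w = inv (shifted_op T w)"

definition laurent_polynomial :: "nat \<Rightarrow> nat \<Rightarrow> (int \<Rightarrow> complex) \<Rightarrow> bool" where
  "laurent_polynomial m k b \<longleftrightarrow>
     m \<ge> 1 \<and> k \<ge> 1 \<and> b (- int m) \<noteq> 0 \<and> b (int k) \<noteq> 0 \<and>
     (\<forall>j. j \<notin> {- int m..int k} \<longrightarrow> b j = 0)"

definition laurent_eval :: "nat \<Rightarrow> nat \<Rightarrow> (int \<Rightarrow> complex) \<Rightarrow> complex \<Rightarrow> complex" where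
  "laurent_eval m k b z = (\<Sum>j = - int m..int k. b j * z powi j)"

definition symbol_curve :: "nat \<Rightarrow> nat \<Rightarrow> (int \<Rightarrow> complex) \<Rightarrow> real \<Rightarrow> complex" where
  "symbol_curve m k b = laurent_eval m k b \<circ> circlepath 0 1"

definition Omega :: "nat \<Rightarrow> nat \<Rightarrow> (int \<Rightarrow> complex) \<Rightarrow> complex set" where
  "Omega m k b = {w. w \<notin> laurent_eval m k b ` sphere 0 1 \<and> winding_number (symbol_curve m k b) w = 0}"

definition symbol_poly :: "nat \<Rightarrow> nat \<Rightarrow> (int \<Rightarrow> complex) \<Rightarrow> complex \<Rightarrow> complex poly" where
  "symbol_poly m k b w = (\<Sum>j = - int m..int k. monom (b j) (nat (j + int m))) - monom w m"

lemma poly_symbol_poly: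
  assumes "z \<noteq> 0"
  shows "poly (symbol_poly m k b w) z = z ^ m * (laurent_eval m k b z - w)"
proof -
  have "poly (monom (b j) (nat (j + int m))) z = z ^ m * (b j * z powi j)"
    if "j \<in> {- int m..int k}" for j
  proof -
    have "z ^ nat (j + int m) = z powi (j + int m)"
      using that by (simp add: power_int_def)
    thus ?thesis
      using assms by (simp add: poly_monom power_int_add)
  qed
  hence "(\<Sum>j = - int m..int k. poly (monom (b j) (nat (j + int m))) z) =
      (\<Sum>j = - int m..int k. z ^ m * (b j * z powi j))"
    by (rule sum.cong[OF refl])
  thus ?thesis
    by (simp add: symbol_poly_def laurent_eval_def poly_sum sum_distrib_left
        poly_monom[of w] right_diff_distrib mult.commute[of w])
qed

definition roots_Z :: "nat \<Rightarrow> nat \<Rightarrow> (int \<Rightarrow> complex) \<Rightarrow> complex \<Rightarrow> complex multiset" where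
  "roots_Z m k b w = proots (symbol_poly m k b w)"

definition Z_in :: "nat \<Rightarrow> nat \<Rightarrow> (int \<Rightarrow> complex) \<Rightarrow> complex \<Rightarrow> complex multiset" where
  "Z_in m k b w = filter_mset (\<lambda>z. cmod z < 1) (roots_Z m k b w)"

definition Z_ext :: "nat \<Rightarrow> nat \<Rightarrow> (int \<Rightarrow> complex) \<Rightarrow> complex \<Rightarrow> complex multiset" where
  "Z_ext m k b w = filter_mset (\<lambda>z. cmod z > 1) (roots_Z m k b w)"

definition regular_laurent :: "nat \<Rightarrow> nat \<Rightarrow> (int \<Rightarrow> complex) \<Rightarrow> bool" where
  "regular_laurent m k b \<longleftrightarrow> laurent_polynomial m k b \<and>
     ((\<exists>r. 0 < r \<and> r < 1 \<and> (\<forall>w\<in>Omega m k b. set_mset (Z_in m k b w) \<subseteq> {z. cmod z \<le> r})) \<or>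
      (\<exists>R. R > 1 \<and> (\<forall>w\<in>Omega m k b. set_mset (Z_ext m k b w) \<subseteq> {z. cmod z \<ge> R})))"

definition LJ_polynomial :: "nat \<Rightarrow> nat \<Rightarrow> (int \<Rightarrow> complex) \<Rightarrow> bool" where
  "LJ_polynomial m k b \<longleftrightarrow> laurent_polynomial m k b \<and>
     inj_on (laurent_eval m k b) (sphere 0 1) \<and>
     (\<forall>t\<in>sphere 0 1. deriv (laurent_eval m k b) t \<noteq> 0)"

text \<open>
  The matrix of the Toeplitz operator depends only on the difference of the row and column
  indices, so indexing by the natural numbers from zero is the same as indexing from one.
  The coefficients of a Laurent polynomial are its Fourier coefficients on the unit circle.
\<close>

definition toeplitz_seq :: "(int \<Rightarrow> complex) \<Rightarrow> (nat \<Rightarrow> complex) \<Rightarrow> nat \<Rightarrow> complex" where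
  "toeplitz_seq b x i = (\<Sum>j. b (int i - int j) * x j)"

definition toeplitz :: "(int \<Rightarrow> complex) \<Rightarrow> ell2 \<Rightarrow> ell2" where
  "toeplitz b x = Abs_ell2 (toeplitz_seq b (Rep_ell2 x))"

text \<open>
  For a Laurent polynomial every row has finitely many nonzero entries, and the operator maps
  into the space of square-summable sequences, so \<^const>\<open>Abs_ell2\<close> is applied inside its domain.
\<close>

lemma toeplitz_seq_eq_sum:
  assumes "laurent_polynomial m k b"
  shows "toeplitz_seq b x i =
    (\<Sum>d = - int m..int k. b d * (if d \<le> int i then x (nat (int i - d)) else 0))"
proof -
  have "toeplitz_seq b x i = (\<Sum>j\<in>{..i + m}. b (int i - int j) * x j)"
    unfolding toeplitz_seq_def using assms
    by (intro suminf_finite) (auto simp: laurent_polynomial_def)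
  also have "\<dots> = (\<Sum>d\<in>{- int m..int i}. b d * x (nat (int i - d)))"
    by (rule sum.reindex_bij_witness[of _ "\<lambda>d. nat (int i - d)" "\<lambda>j. int i - int j"]) auto
  also have "\<dots> = (\<Sum>d = - int m..int k. b d * (if d \<le> int i then x (nat (int i - d)) else 0))"
    using assms by (intro sum.mono_neutral_cong) (auto simp: laurent_polynomial_def)
  finally show ?thesis .
qed

lemma square_summable_shift:
  assumes "square_summable x"
  shows "square_summable (\<lambda>i. if d \<le> int i then x (nat (int i - d)) else 0)"
proof -
  have s: "summable (\<lambda>n. (cmod (x n))\<^sup>2)"
    using assms by (simp add: square_summable_def)
  show ?thesis
  proof (cases "d \<ge> 0")
    case True
    have "summable (\<lambda>i. (cmod (if d \<le> int (i + nat d) then x (nat (int (i + nat d) - d)) else 0))\<^sup>2)"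
      using s True by simp
    thus ?thesis
      unfolding square_summable_def by (subst (asm) summable_iff_shift)
  next
    case False
    have "nat (int i - d) = i + nat (- d)" for i using False by simp
    moreover have "d \<le> int i" for i using False by simp
    ultimately show ?thesis
      unfolding square_summable_def using summable_iff_shift[of "\<lambda>n. (cmod (x n))\<^sup>2" "nat (- d)"] s
      by simp
  qed
qed

lemma Rep_toeplitz:
  assumes "laurent_polynomial m k b"
  shows "Rep_ell2 (toeplitz b x) = toeplitz_seq b (Rep_ell2 x)"
  unfolding toeplitz_def
proof (rule Rep_Abs_ell2)
  show "square_summable (toeplitz_seq b (Rep_ell2 x))"
    unfolding toeplitz_seq_eq_sum[OF assms, abs_def]
    by (intro square_summable_sum square_summable_mult square_summable_shift square_summable_Rep)
qed

end

theory Submission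
  imports Defs "HOL-Computational_Algebra.Polynomial_FPS"
    "HOL-Computational_Algebra.Fundamental_Theorem_Algebra"
begin

text \<open>
  Identify a square-summable sequence with a formal power series.  Multiplication by the variable
  is the forward shift, \<^term>\<open>fps_shift 1\<close> is the backward shift \<open>B\<close>, and \<open>T_b - w\<close> becomes
  \<open>f \<mapsto> B^m (P f)\<close>, where \<open>P(z) = z^m (b(z) - w)\<close>.  Splitting \<open>P\<close> into linear factors turns
  questions about the operator into questions about roots: a factor \<open>z - \<zeta>\<close> that meets one of
  the \<open>m\<close> backward shifts becomes \<open>1 - \<zeta> B\<close>, and the remaining factors stay multiplication operators.

  If \<open>w\<close> belongs to the resolvent set, then \<open>P\<close> has no root on the unit circle (it would produce
  approximate eigenvectors) and exactly \<open>m\<close> roots inside it (more destroy surjectivity, fewer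
  produce a kernel).  The winding number of the symbol curve around \<open>w\<close> is the number of inner
  roots minus \<open>m\<close>, so the resolvent set is contained in \<open>\<Omega>(b)\<close>, where regularity applies.

  With exactly \<open>m\<close> inner roots the operator is the product of an upper triangular factor, carrying
  the inner roots, and a lower triangular factor, carrying the outer roots.  Suppose that the inner
  roots stay in \<open>|z| \<le> r\<close>.  Then each \<open>1 - \<zeta> B\<close> shrinks norms at most by \<open>1 - |\<zeta>|\<close>, by the triangle
  inequality alone.  The other factor is multiplication by a polynomial, which by Parseval's identity
  shrinks norms at most by the minimum of its modulus on the circle; there this modulus is
  \<open>|b - w|\<close> divided by \<open>\<Prod>|t - \<zeta>|\<close>, and \<open>|b - w|\<close> is at least the distance of \<open>w\<close> from the
  spectrum because the spectrum contains the curve.  The quotients \<open>(1 - |\<zeta>|) / (1 + |\<zeta>|)\<close> that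
  remain are bounded below through \<open>r\<close>, which gives the constant \<open>((1 + r) / (1 - r))^m\<close>.  If instead
  the outer roots stay away from the circle, the two factors exchange roles: the triangle inequality
  handles the multiplication operator, and the upper triangular factor is bounded by passing to its
  adjoint, which is again multiplication by a polynomial.  The lemmas
  \<open>shifted_op_lower_bound_inner\<close> and \<open>shifted_op_lower_bound_outer\<close> are these two cases.

  A Laurent polynomial with the Jordan property is injective on an annulus around the circle, so for
  \<open>z\<close> in this annulus \<open>z\<close> itself is the only root of \<open>b - b(z)\<close> there.  The number of roots inside
  the smaller boundary circle does not depend on \<open>z\<close>, being a winding number on a connected set.
  Hence the number of roots in the unit disc is larger for \<open>z\<close> just inside the unit circle than for
  \<open>z\<close> just outside, and it cannot be \<open>m\<close> on both sides.  On one side the annulus is therefore mapped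
  outside \<open>\<Omega>(b)\<close>, which is regularity.
\<close>

unbundle fps_syntax

section \<open>Completeness of the sequence space\<close>

lemma norm_ell2_sq: "(norm x)\<^sup>2 = (\<Sum>n. (cmod (Rep_ell2 x n))\<^sup>2)"
  using square_summable_Rep[of x]
  by (simp add: norm_ell2_def suminf_nonneg square_summable_def)

lemma partial_sum_le_norm_ell2: "(\<Sum>n<N. (cmod (Rep_ell2 x n))\<^sup>2) \<le> (norm x)\<^sup>2"
  unfolding norm_ell2_sq using square_summable_Rep[of x]
  by (intro sum_le_suminf) (auto simp: square_summable_def)

lemma cmod_le_norm_ell2: "cmod (Rep_ell2 x n) \<le> norm x"
proof -
  have "(cmod (Rep_ell2 x n))\<^sup>2 \<le> (\<Sum>i<Suc n. (cmod (Rep_ell2 x i))\<^sup>2)"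
    by (intro member_le_sum) auto
  also have "\<dots> \<le> (norm x)\<^sup>2"
    by (rule partial_sum_le_norm_ell2)
  finally show ?thesis
    by (rule power2_le_imp_le) simp
qed

lemma square_summable_bounded:
  assumes "\<And>N. (\<Sum>n<N. (cmod (x n))\<^sup>2) \<le> c\<^sup>2"
  shows "square_summable x"
  unfolding square_summable_def
proof (rule bounded_imp_summable)
  show "(\<Sum>k\<le>N. (cmod (x k))\<^sup>2) \<le> c\<^sup>2" for N
    using assms[of "Suc N"] by (simp only: lessThan_Suc_atMost)
qed simp

lemma norm_ell2_leI:
  assumes "\<And>N. (\<Sum>n<N. (cmod (Rep_ell2 x n))\<^sup>2) \<le> c\<^sup>2" "c \<ge> 0"
  shows "norm x \<le> c"
proof -
  have "(norm x)\<^sup>2 \<le> c\<^sup>2"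
    unfolding norm_ell2_sq using square_summable_Rep[of x] assms(1)
    by (intro suminf_le_const) (auto simp: square_summable_def)
  thus ?thesis
    using assms(2) by (rule power2_le_imp_le)
qed

instance ell2 :: complete_space
proof
  fix X :: "nat \<Rightarrow> ell2"
  assume C: "Cauchy X"
  have "Cauchy (\<lambda>i. Rep_ell2 (X i) n)" for n
  proof (rule metric_CauchyI)
    fix e :: real
    assume "e > 0"
    then obtain M where M: "\<And>i j. i \<ge> M \<Longrightarrow> j \<ge> M \<Longrightarrow> dist (X i) (X j) < e"
      using metric_CauchyD[OF C] by blast
    have "dist (Rep_ell2 (X i) n) (Rep_ell2 (X j) n) < e" if "i \<ge> M" "j \<ge> M" for i j
      using M[OF that] cmod_le_norm_ell2[of "X i - X j" n]
      by (simp add: dist_norm Rep_ell2_simps)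
    thus "\<exists>M. \<forall>i\<ge>M. \<forall>j\<ge>M. dist (Rep_ell2 (X i) n) (Rep_ell2 (X j) n) < e"
      by blast
  qed
  hence "\<exists>l. (\<lambda>i. Rep_ell2 (X i) n) \<longlonglongrightarrow> l" for n
    using Cauchy_convergent convergent_def by blast
  then obtain x where x: "\<And>n. (\<lambda>i. Rep_ell2 (X i) n) \<longlonglongrightarrow> x n"
    by metis
  have close: "\<exists>M. \<forall>i\<ge>M. \<forall>N. (\<Sum>n<N. (cmod (Rep_ell2 (X i) n - x n))\<^sup>2) \<le> e\<^sup>2" if e: "e > 0" for e
  proof -
    obtain M where M: "\<And>i j. i \<ge> M \<Longrightarrow> j \<ge> M \<Longrightarrow> dist (X i) (X j) < e"
      using metric_CauchyD[OF C e] by blast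
    have "(\<Sum>n<N. (cmod (Rep_ell2 (X i) n - x n))\<^sup>2) \<le> e\<^sup>2" if "i \<ge> M" for i N
    proof (rule tendsto_upperbound)
      show "(\<lambda>j. \<Sum>n<N. (cmod (Rep_ell2 (X i) n - Rep_ell2 (X j) n))\<^sup>2) \<longlonglongrightarrow>
          (\<Sum>n<N. (cmod (Rep_ell2 (X i) n - x n))\<^sup>2)"
        by (intro tendsto_intros x)
      have "(\<Sum>n<N. (cmod (Rep_ell2 (X i) n - Rep_ell2 (X j) n))\<^sup>2) \<le> e\<^sup>2" if "j \<ge> M" for j
      proof -
        have "(\<Sum>n<N. (cmod (Rep_ell2 (X i) n - Rep_ell2 (X j) n))\<^sup>2) \<le> (norm (X i - X j))\<^sup>2"
          using partial_sum_le_norm_ell2[of "X i - X j" N] by (simp add: Rep_ell2_simps)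
        also have "\<dots> \<le> e\<^sup>2"
          using M[OF \<open>i \<ge> M\<close> that] by (intro power_mono) (auto simp: dist_norm)
        finally show ?thesis .
      qed
      thus "\<forall>\<^sub>F j in sequentially. (\<Sum>n<N. (cmod (Rep_ell2 (X i) n - Rep_ell2 (X j) n))\<^sup>2) \<le> e\<^sup>2"
        using eventually_sequentially by blast
    qed simp
    thus ?thesis by blast
  qed
  have x_ss: "square_summable x"
  proof -
    obtain M where "\<And>N. (\<Sum>n<N. (cmod (Rep_ell2 (X M) n - x n))\<^sup>2) \<le> 1\<^sup>2"
      using close[of 1] by auto
    hence "square_summable (\<lambda>n. Rep_ell2 (X M) n - x n)"
      by (rule square_summable_bounded)
    from square_summable_add[OF square_summable_Rep[of "X M"] square_summable_mult[OF this, of "-1"]]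
    show ?thesis by simp
  qed
  have "X \<longlonglongrightarrow> Abs_ell2 x"
  proof (rule metric_LIMSEQ_I)
    fix e :: real
    assume e: "e > 0"
    obtain M where M: "\<And>i N. i \<ge> M \<Longrightarrow> (\<Sum>n<N. (cmod (Rep_ell2 (X i) n - x n))\<^sup>2) \<le> (e/2)\<^sup>2"
      using close[of "e/2"] e by auto
    have "dist (X i) (Abs_ell2 x) < e" if "i \<ge> M" for i
    proof -
      have "norm (X i - Abs_ell2 x) \<le> e/2"
        using e by (intro norm_ell2_leI) (simp_all add: Rep_ell2_simps Rep_Abs_ell2 x_ss M[OF that])
      thus ?thesis using e by (simp add: dist_norm)
    qed
    thus "\<exists>M. \<forall>i\<ge>M. dist (X i) (Abs_ell2 x) < e" by blast
  qed
  thus "convergent X"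
    by (auto simp: convergent_def)
qed

text \<open>
  A solution is a fixed point of the contraction \<open>x \<mapsto> y + L x\<close>.
\<close>

lemma perturbed_identity_surj:
  fixes L :: "'a :: {real_normed_vector, complete_space} \<Rightarrow> 'a"
  assumes diff: "\<And>x y. L (x - y) = L x - L y"
    and le: "\<And>x. norm (L x) \<le> q * norm x" and q: "0 \<le> q" "q < 1"
  obtains x where "x - L x = y"
proof -
  have "\<exists>!x. y + L x = x"
    by (rule banach_fix_type[OF q]) (use diff le in \<open>auto simp: dist_norm simp flip: diff\<close>)
  then obtain x where "y + L x = x" by blast
  hence "x - L x = y" by (metis add_diff_cancel_right')
  thus ?thesis by (rule that)
qed

section \<open>The Hardy space as a space of formal power series\<close>

text \<open>
  In the ring of power series, multiplication by a polynomial in the forward shift is commutative and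
  associative, so the factors of a symbol can be rearranged freely.  The functions \<open>series_of\<close> and
  \<open>ell2_of\<close> are inverse to each other on the series with square-summable coefficients.
\<close>

definition hardy :: "complex fps \<Rightarrow> bool" where
  "hardy f \<longleftrightarrow> summable (\<lambda>n. (cmod (f $ n))\<^sup>2)"

definition ell2_of :: "complex fps \<Rightarrow> ell2" where
  "ell2_of f = Abs_ell2 (fps_nth f)"

definition series_of :: "ell2 \<Rightarrow> complex fps" where
  "series_of x = Abs_fps (Rep_ell2 x)"

definition hnorm :: "complex fps \<Rightarrow> real" where
  "hnorm f = norm (ell2_of f)"

lemma hardy_iff_square_summable: "hardy f \<longleftrightarrow> square_summable (fps_nth f)"
  by (simp add: hardy_def square_summable_def)

lemma series_of_nth [simp]: "series_of x $ n = Rep_ell2 x n"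
  by (simp add: series_of_def)

lemma hardy_series_of [simp, intro]: "hardy (series_of x)"
  using square_summable_Rep[of x] by (simp add: hardy_def square_summable_def)

lemma Rep_ell2_of: "hardy f \<Longrightarrow> Rep_ell2 (ell2_of f) = fps_nth f"
  by (simp add: hardy_iff_square_summable ell2_of_def Rep_Abs_ell2)

lemma series_of_ell2_of: "hardy f \<Longrightarrow> series_of (ell2_of f) = f"
  by (simp add: fps_eq_iff Rep_ell2_of)

lemma ell2_of_series_of [simp]: "ell2_of (series_of x) = x"
  by (simp flip: Rep_ell2_inject add: fun_eq_iff Rep_ell2_of)

lemma series_of_inject: "series_of x = series_of y \<longleftrightarrow> x = y"
  by (metis ell2_of_series_of)

lemma hnorm_series_of [simp]: "hnorm (series_of x) = norm x"
  by (simp add: hnorm_def)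

lemma series_of_add: "series_of (x + y) = series_of x + series_of y"
  and series_of_diff: "series_of (x - y) = series_of x - series_of y"
  and series_of_scaleR: "series_of (r *\<^sub>R x) = fps_const (of_real r) * series_of x"
  and series_of_scaleC: "series_of (scaleC_ell2 c x) = fps_const c * series_of x"
  and series_of_zero: "series_of 0 = 0"
  by (simp_all add: fps_eq_iff Rep_ell2_simps Rep_scaleC_ell2 scaleR_conv_of_real)

lemma hardy_zero [simp]: "hardy 0"
  by (simp add: hardy_def)

lemma hardy_const_mult [intro]: "hardy f \<Longrightarrow> hardy (fps_const c * f)"
  using square_summable_mult[of "fps_nth f" c] by (simp add: hardy_def square_summable_def)

lemma hardy_add [intro]: "hardy f \<Longrightarrow> hardy g \<Longrightarrow> hardy (f + g)"
  using square_summable_add[of "fps_nth f" "fps_nth g"] by (simp add: hardy_def square_summable_def)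

lemma hardy_diff [intro]: "hardy f \<Longrightarrow> hardy g \<Longrightarrow> hardy (f - g)"
  using hardy_add[of f "fps_const (-1) * g"] hardy_const_mult[of g "-1"]
  by (simp flip: fps_const_neg)

lemma hardy_shift [intro]: "hardy f \<Longrightarrow> hardy (fps_shift n f)"
  using summable_iff_shift[of "\<lambda>i. (cmod (f $ i))\<^sup>2" n] by (simp add: hardy_def)

lemma fps_shift_X_mult: "fps_shift (Suc 0) (fps_X * f) = (f :: complex fps)"
  by (simp add: fps_eq_iff)

lemma hardy_X_mult [intro]: "hardy f \<Longrightarrow> hardy (fps_X * f)"
  using summable_iff_shift[of "\<lambda>i. (cmod ((fps_X * f) $ i))\<^sup>2" 1] by (simp add: hardy_def)

lemma hardy_of_poly [simp, intro]: "hardy (fps_of_poly p)"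
  unfolding hardy_def fps_of_poly_nth
  by (rule summable_finite[of "{..degree p}"]) (auto simp: coeff_eq_0 not_le)

lemma hardy_poly_mult [intro]: "hardy f \<Longrightarrow> hardy (fps_of_poly p * f)"
  by (induction p)
     (auto simp: fps_of_poly_pCons distrib_right mult.assoc mult.commute[of _ fps_X])

lemma hnorm_sq: "hardy f \<Longrightarrow> (hnorm f)\<^sup>2 = (\<Sum>n. (cmod (f $ n))\<^sup>2)"
  by (simp add: hnorm_def norm_ell2_sq Rep_ell2_of)

lemma hnorm_nonneg [simp]: "0 \<le> hnorm f"
  by (simp add: hnorm_def)

lemma ell2_of_add: "hardy f \<Longrightarrow> hardy g \<Longrightarrow> ell2_of (f + g) = ell2_of f + ell2_of g"
  and ell2_of_diff: "hardy f \<Longrightarrow> hardy g \<Longrightarrow> ell2_of (f - g) = ell2_of f - ell2_of g"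
  and ell2_of_const_mult: "hardy f \<Longrightarrow> ell2_of (fps_const c * f) = scaleC_ell2 c (ell2_of f)"
  by (metis hardy_series_of series_of_add series_of_diff series_of_scaleC series_of_ell2_of ell2_of_series_of)+

lemma hnorm_eq_0_iff: "hardy f \<Longrightarrow> hnorm f = 0 \<longleftrightarrow> f = 0"
  unfolding hnorm_def norm_eq_zero by (metis series_of_ell2_of series_of_zero ell2_of_series_of)

lemma norm_scaleC_ell2: "norm (scaleC_ell2 c x) = cmod c * norm x"
proof -
  have "(norm (scaleC_ell2 c x))\<^sup>2 = (cmod c * norm x)\<^sup>2"
    using square_summable_Rep[of x]
    by (simp add: norm_ell2_sq Rep_scaleC_ell2 norm_mult power_mult_distrib suminf_mult
        square_summable_def)
  thus ?thesis by (simp add: power2_eq_iff_nonneg)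
qed

lemma hnorm_const_mult: "hardy f \<Longrightarrow> hnorm (fps_const c * f) = cmod c * hnorm f"
  by (simp add: hnorm_def ell2_of_const_mult norm_scaleC_ell2)

lemma hnorm_triangle: "hardy f \<Longrightarrow> hardy g \<Longrightarrow> hnorm (f + g) \<le> hnorm f + hnorm g"
  by (simp add: hnorm_def ell2_of_add norm_triangle_ineq)

lemma hnorm_diff_ge: "hardy f \<Longrightarrow> hardy g \<Longrightarrow> hnorm f - hnorm g \<le> hnorm (f - g)"
  by (simp add: hnorm_def ell2_of_diff norm_triangle_ineq2)

lemma hnorm_minus_commute: "hardy f \<Longrightarrow> hardy g \<Longrightarrow> hnorm (f - g) = hnorm (g - f)"
  by (simp add: hnorm_def ell2_of_diff norm_minus_commute)

lemma hnorm_sq_shift: "hardy f \<Longrightarrow> (hnorm (fps_shift n f))\<^sup>2 = (hnorm f)\<^sup>2 - (\<Sum>i<n. (cmod (f $ i))\<^sup>2)"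
  using suminf_minus_initial_segment[of "\<lambda>i. (cmod (f $ i))\<^sup>2" n]
  by (simp add: hnorm_sq hardy_shift) (simp add: hardy_def)

lemma hnorm_shift_le: "hardy f \<Longrightarrow> hnorm (fps_shift n f) \<le> hnorm f"
  by (rule power2_le_imp_le) (simp_all add: hnorm_sq_shift sum_nonneg)

lemma hnorm_X_mult: "hardy f \<Longrightarrow> hnorm (fps_X * f) = hnorm f"
  using hnorm_sq_shift[of "fps_X * f" 1] by (simp add: hardy_X_mult power2_eq_iff_nonneg fps_shift_X_mult)

lemma hardy_coeff_tendsto_0: "hardy f \<Longrightarrow> (\<lambda>n. f $ n) \<longlonglongrightarrow> 0"
  unfolding hardy_def
  by (drule summable_LIMSEQ_zero) (simp add: tendsto_norm_zero_iff)

lemma poly_mult_bounded: "\<exists>K\<ge>0. \<forall>f. hardy f \<longrightarrow> hnorm (fps_of_poly p * f) \<le> K * hnorm f"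
proof (induction p)
  case 0
  have "hnorm 0 = 0" using hnorm_series_of[of 0] by (simp add: series_of_zero)
  thus ?case by (auto intro!: exI[of _ 0])
next
  case (pCons a p)
  then obtain K where K: "K \<ge> 0" "\<And>f. hardy f \<Longrightarrow> hnorm (fps_of_poly p * f) \<le> K * hnorm f"
    by blast
  show ?case
  proof (intro exI[of _ "cmod a + K"] conjI allI impI)
    fix f assume f: "hardy f"
    have "hnorm (fps_of_poly (pCons a p) * f) = hnorm (fps_const a * f + fps_X * (fps_of_poly p * f))"
      by (simp add: fps_of_poly_pCons algebra_simps)
    also have "\<dots> \<le> cmod a * hnorm f + K * hnorm f"
      using hnorm_triangle[of "fps_const a * f" "fps_X * (fps_of_poly p * f)"] K(2)[OF f] f
      by (simp add: hnorm_const_mult hnorm_X_mult hardy_X_mult hardy_poly_mult hardy_const_mult)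
    finally show "hnorm (fps_of_poly (pCons a p) * f) \<le> (cmod a + K) * hnorm f"
      by (simp add: algebra_simps)
  qed (use K in auto)
qed

section \<open>Factors of Toeplitz operators\<close>

text \<open>
  The polynomial with given roots, its reversal, and the operator \<open>\<Prod>(1 - \<zeta> B)\<close> with \<open>B\<close> the backward
  shift, whose adjoint is multiplication by the reversal with conjugated parameters.  Lists rather
  than multisets allow structural induction; the order of the entries never matters.
\<close>

definition root_poly :: "complex list \<Rightarrow> complex poly" where
  "root_poly zs = (\<Prod>z\<leftarrow>zs. [:- z, 1:])"

definition rev_root_poly :: "complex list \<Rightarrow> complex poly" where
  "rev_root_poly zs = (\<Prod>z\<leftarrow>zs. [:1, - z:])"

definition back_prod :: "complex list \<Rightarrow> complex fps \<Rightarrow> complex fps" where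
  "back_prod zs f = foldr (\<lambda>z g. g - fps_const z * fps_shift 1 g) zs f"

lemma root_poly_simps [simp]:
  "root_poly [] = 1" "root_poly (z # zs) = [:- z, 1:] * root_poly zs"
  by (simp_all add: root_poly_def)

lemma rev_root_poly_simps [simp]:
  "rev_root_poly [] = 1" "rev_root_poly (z # zs) = [:1, - z:] * rev_root_poly zs"
  by (simp_all add: rev_root_poly_def)

lemma root_poly_append: "root_poly (xs @ ys) = root_poly xs * root_poly ys"
  by (simp add: root_poly_def)

lemma back_prod_simps [simp]:
  "back_prod [] f = f"
  "back_prod (z # zs) f = back_prod zs f - fps_const z * fps_shift 1 (back_prod zs f)"
  by (simp_all add: back_prod_def)

lemma poly_root_poly: "poly (root_poly zs) t = (\<Prod>z\<leftarrow>zs. t - z)"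
  by (induction zs) (auto simp: algebra_simps)

lemma root_poly_nonzero [simp]: "root_poly zs \<noteq> 0"
  unfolding root_poly_def by (induction zs) (auto simp del: mult_pCons_left)

lemma prod_list_mset_root_poly: "(\<Prod>z\<in>#mset zs. [:- z, 1:]) = root_poly zs"
  by (induction zs) (simp_all del: mult_pCons_left)

lemma degree_root_poly: "degree (root_poly zs) = length zs"
proof (induction zs)
  case (Cons z zs)
  thus ?case by (simp del: mult_pCons_left add: degree_mult_eq)
qed simp

lemma linear_factor_mult_nth:
  "(fps_of_poly [:- z, 1:] * f) $ Suc n = f $ n - z * (f $ Suc n :: complex)"
  by (simp add: fps_of_poly_linear left_diff_distrib flip: fps_const_neg)

text \<open>
  Since \<open>B\<close> is a left inverse of the forward shift \<open>F\<close>, we have \<open>B (F - \<zeta>) = 1 - \<zeta> B\<close>, and these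
  operators commute with the remaining powers of \<open>B\<close>.  This is how each inner root of the symbol
  absorbs one of the \<open>m\<close> backward shifts.
\<close>

lemma fps_shift_root_poly_mult:
  "fps_shift (length zs) (fps_of_poly (root_poly zs) * f) = back_prod zs f"
proof (induction zs)
  case (Cons z zs)
  define g where "g = fps_of_poly (root_poly zs) * f"
  have *: "back_prod zs f $ i = g $ (i + length zs)" for i
    using Cons by (simp add: fps_eq_iff g_def)
  have "fps_of_poly (root_poly (z # zs)) * f = fps_of_poly [:- z, 1:] * g"
    by (simp add: g_def fps_of_poly_mult mult.assoc del: mult_pCons_left)
  thus ?case
    by (simp add: fps_eq_iff linear_factor_mult_nth * )
qed simp

lemma hardy_back_prod [intro]: "hardy f \<Longrightarrow> hardy (back_prod zs f)"
  by (induction zs) (auto intro!: hardy_diff hardy_const_mult hardy_shift)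

text \<open>
  The backward shift is a contraction, so each factor satisfies
  \<open>\<parallel>g - \<zeta> B g\<parallel> \<ge> (1 - |\<zeta>|) \<parallel>g\<parallel>\<close>.
\<close>

lemma back_prod_lower_bound:
  assumes "hardy f" "\<And>z. z \<in> set zs \<Longrightarrow> cmod z \<le> 1"
  shows "(\<Prod>z\<leftarrow>zs. 1 - cmod z) * hnorm f \<le> hnorm (back_prod zs f)"
  using assms(2)
proof (induction zs)
  case (Cons z zs)
  let ?g = "back_prod zs f"
  have g: "hardy ?g" using assms(1) by blast
  have "(\<Prod>z\<leftarrow>z # zs. 1 - cmod z) * hnorm f = (1 - cmod z) * ((\<Prod>z\<leftarrow>zs. 1 - cmod z) * hnorm f)"
    by simp
  also have "\<dots> \<le> (1 - cmod z) * hnorm ?g"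
    using Cons by (intro mult_left_mono Cons.IH) auto
  also have "\<dots> \<le> hnorm ?g - hnorm (fps_const z * fps_shift 1 ?g)"
    using mult_left_mono[OF hnorm_shift_le[OF g, of 1], of "cmod z"]
    by (simp add: hnorm_const_mult hardy_shift g algebra_simps)
  also have "\<dots> \<le> hnorm (back_prod (z # zs) f)"
    using hnorm_diff_ge[of ?g "fps_const z * fps_shift 1 ?g"] g by (simp add: hardy_shift hardy_const_mult)
  finally show ?case .
qed simp

lemma back_prod_diff: "back_prod zs (f - g) = back_prod zs f - back_prod zs g"
  unfolding fps_shift_root_poly_mult[symmetric] by (simp add: right_diff_distrib fps_eq_iff)

lemma back_prod_inject:
  assumes "hardy f" "hardy g" "\<And>z. z \<in> set zs \<Longrightarrow> cmod z < 1" "back_prod zs f = back_prod zs g"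
  shows "f = g"
proof -
  have "(\<Prod>z\<leftarrow>zs. 1 - cmod z) * hnorm (f - g) \<le> hnorm (back_prod zs (f - g))"
    using assms by (intro back_prod_lower_bound hardy_diff) (auto intro: less_imp_le)
  also have "\<dots> = 0"
    using assms hnorm_eq_0_iff[OF hardy_zero] by (simp add: back_prod_diff)
  finally have "(\<Prod>z\<leftarrow>zs. 1 - cmod z) * hnorm (f - g) \<le> 0" .
  moreover have "(\<Prod>z\<leftarrow>zs. 1 - cmod z) > 0"
    using assms(3) by (induction zs) auto
  ultimately have "hnorm (f - g) = 0"
    by (simp add: mult_le_0_iff antisym)
  thus ?thesis
    using hnorm_eq_0_iff[of "f - g"] assms by auto
qed

text \<open>
  The forward shift is isometric, so each factor satisfies
  \<open>\<parallel>(F - \<zeta>) g\<parallel> \<ge> (|\<zeta>| - 1) \<parallel>g\<parallel>\<close>.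
\<close>

lemma root_poly_lower_bound:
  assumes "hardy f" "\<And>z. z \<in> set zs \<Longrightarrow> 1 \<le> cmod z"
  shows "(\<Prod>z\<leftarrow>zs. cmod z - 1) * hnorm f \<le> hnorm (fps_of_poly (root_poly zs) * f)"
  using assms(2)
proof (induction zs)
  case (Cons z zs)
  let ?g = "fps_of_poly (root_poly zs) * f"
  have g: "hardy ?g" using assms(1) by blast
  have eq: "fps_of_poly (root_poly (z # zs)) * f = fps_X * ?g - fps_const z * ?g"
    unfolding root_poly_simps fps_of_poly_mult fps_of_poly_linear
    by (simp add: algebra_simps flip: fps_const_neg)
  have "(\<Prod>z\<leftarrow>z # zs. cmod z - 1) * hnorm f = (cmod z - 1) * ((\<Prod>z\<leftarrow>zs. cmod z - 1) * hnorm f)"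
    by simp
  also have "\<dots> \<le> (cmod z - 1) * hnorm ?g"
    using Cons by (intro mult_left_mono Cons.IH) auto
  also have "\<dots> = hnorm (fps_const z * ?g) - hnorm (fps_X * ?g)"
    by (simp add: hnorm_const_mult hnorm_X_mult g left_diff_distrib)
  also have "\<dots> \<le> hnorm (fps_X * ?g - fps_const z * ?g)"
    using hnorm_diff_ge[of "fps_const z * ?g" "fps_X * ?g"] g
      hnorm_minus_commute[of "fps_const z * ?g" "fps_X * ?g"]
    by (simp add: hardy_X_mult hardy_const_mult)
  finally show ?case by (simp only: eq)
qed simp

text \<open>
  The formal quotient of \<open>g\<close> by \<open>1 - z X\<close> has square-summable coefficients because multiplication
  by \<open>z X\<close> is a strict contraction of a complete space.
\<close>

lemma one_minus_X_solvable:
  assumes "cmod z < 1" "hardy g"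
  obtains f where "hardy f" "fps_of_poly [:1, - z:] * f = g"
proof -
  define L where "L x = ell2_of (fps_const z * (fps_X * series_of x))" for x
  have series_of_L: "series_of (L x) = fps_const z * (fps_X * series_of x)" for x
    unfolding L_def by (intro series_of_ell2_of hardy_const_mult hardy_X_mult hardy_series_of)
  obtain x where "x - L x = ell2_of g"
  proof (rule perturbed_identity_surj[of L "cmod z"])
    show "L (x - y) = L x - L y" for x y
      by (simp add: series_of_L series_of_diff algebra_simps flip: series_of_inject)
    show "norm (L x) \<le> cmod z * norm x" for x
      by (simp add: series_of_L hnorm_const_mult hnorm_X_mult hardy_X_mult flip: hnorm_series_of)
  qed (use assms in auto)
  hence "series_of x - series_of (L x) = g"
    using assms(2) by (metis series_of_diff series_of_ell2_of)
  hence "fps_of_poly [:1, - z:] * series_of x = g"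
    by (simp add: series_of_L fps_of_poly_linear' algebra_simps flip: fps_const_neg)
  thus ?thesis using that by blast
qed

lemma rev_root_poly_solvable:
  assumes "\<And>z. z \<in> set zs \<Longrightarrow> cmod z < 1" "hardy g"
  shows "\<exists>f. hardy f \<and> fps_of_poly (rev_root_poly zs) * f = g"
  using assms
proof (induction zs arbitrary: g)
  case (Cons z zs)
  obtain h where h: "hardy h" "fps_of_poly [:1, - z:] * h = g"
    using one_minus_X_solvable[of z g] Cons.prems by auto
  obtain f where "hardy f" "fps_of_poly (rev_root_poly zs) * f = h"
    using Cons.IH[of h] Cons.prems h by auto
  thus ?case using h
    by (auto intro!: exI[of _ f] simp: fps_of_poly_mult mult.assoc simp del: mult_pCons_left)
qed auto

text \<open>
  The forward and the backward shift are adjoint to each other.  The real inner product is the real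
  part of the Hermitian one, so the adjoint of multiplication by \<open>z\<close> is multiplication by \<open>cnj z\<close>.
\<close>

lemma linear_factor_adjoint:
  assumes "hardy f" "hardy g"
  shows "ell2_of (fps_of_poly [:1, - cnj z:] * f) \<bullet> ell2_of g = ell2_of f \<bullet> ell2_of (g - fps_const z * fps_shift 1 g)"
proof -
  have inner: "ell2_of u \<bullet> ell2_of v = (\<Sum>n. u $ n \<bullet> v $ n)" "summable (\<lambda>n. u $ n \<bullet> v $ n)"
    if "hardy u" "hardy v" for u v
    using that square_summable_inner[of "fps_nth u" "fps_nth v"]
    by (auto simp: inner_ell2_def Rep_ell2_of hardy_iff_square_summable)
  have h: "hardy (fps_X * f)" "hardy (fps_shift 1 g)"
    using assms by auto
  have X: "ell2_of (fps_X * f) \<bullet> ell2_of u = ell2_of f \<bullet> ell2_of (fps_shift 1 u)" if "hardy u" for u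
    using suminf_split_head[OF inner(2)[OF h(1) that]] that assms(1)
    by (simp add: inner hardy_X_mult hardy_shift)
  have const: "ell2_of (fps_const (cnj z) * u) \<bullet> ell2_of v = ell2_of u \<bullet> ell2_of (fps_const z * v)"
    if "hardy u" "hardy v" for u v
    using that by (simp add: inner hardy_const_mult) (simp add: inner_complex_def algebra_simps)
  have "ell2_of (fps_of_poly [:1, - cnj z:] * f) = ell2_of (f - fps_const (cnj z) * (fps_X * f))"
    by (simp add: fps_of_poly_linear' algebra_simps flip: fps_const_neg)
  moreover have "fps_shift (Suc 0) (fps_const z * g) = fps_const z * fps_shift (Suc 0) g"
    by (simp add: fps_eq_iff)
  ultimately show ?thesis
    using assms h const[of "fps_X * f" g] X[of "fps_const z * g"]
    by (simp add: ell2_of_diff hardy_const_mult inner_diff_left inner_diff_right)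
qed

lemma back_prod_adjoint:
  assumes "hardy f" "hardy g"
  shows "ell2_of (fps_of_poly (rev_root_poly (map cnj zs)) * f) \<bullet> ell2_of g = ell2_of f \<bullet> ell2_of (back_prod zs g)"
  using assms(1)
proof (induction zs arbitrary: f)
  case (Cons z zs)
  have "ell2_of (fps_of_poly (rev_root_poly (map cnj (z # zs))) * f) \<bullet> ell2_of g =
      ell2_of (fps_of_poly (rev_root_poly (map cnj zs)) * (fps_of_poly [:1, - cnj z:] * f)) \<bullet> ell2_of g"
    unfolding list.map rev_root_poly_simps fps_of_poly_mult by (simp add: mult_ac)
  also have "\<dots> = ell2_of (fps_of_poly [:1, - cnj z:] * f) \<bullet> ell2_of (back_prod zs g)"
    using Cons by (intro Cons.IH) auto
  also have "\<dots> = ell2_of f \<bullet> ell2_of (back_prod (z # zs) g)"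
    using linear_factor_adjoint[of f "back_prod zs g"] Cons assms by auto
  finally show ?case .
qed auto

section \<open>Multiplication by a polynomial that is large on the circle\<close>

text \<open>
  Orthogonality of the characters of the cyclic group of order \<open>N\<close>.
\<close>

lemma sum_unity_root_powers:
  assumes "n < N" "l < N"
  shows "(\<Sum>j<N. cis (2 * pi * real j / real N) ^ n * cnj (cis (2 * pi * real j / real N)) ^ l) =
    (if n = l then of_nat N else 0)"
proof -
  define v where "v = cis (2 * pi * (real n - real l) / real N)"
  have N: "N > 0" using assms by simp
  have "cis (2 * pi * real j / real N) ^ n * cnj (cis (2 * pi * real j / real N)) ^ l = v ^ j" for j
    unfolding v_def cis_cnj Complex.DeMoivre cis_mult using N
    by (intro arg_cong[where f = cis]) (simp add: field_simps)
  hence eq: "(\<Sum>j<N. cis (2 * pi * real j / real N) ^ n * cnj (cis (2 * pi * real j / real N)) ^ l) =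
      (\<Sum>j<N. v ^ j)" by simp
  show ?thesis
  proof (cases "n = l")
    case True
    thus ?thesis unfolding eq by (simp add: v_def)
  next
    case False
    have "v ^ N = cis (2 * pi * of_int (int n - int l))"
      using N by (simp add: v_def Complex.DeMoivre)
    hence "v ^ N = 1"
      by (simp only: cis_multiple_2pi Ints_of_int)
    moreover have "v \<noteq> 1"
    proof
      assume "v = 1"
      hence "exp (\<i> * complex_of_real (2 * pi * (real n - real l) / real N)) = 1"
        by (simp add: v_def cis_conv_exp)
      then obtain i :: int where "2 * pi * (real n - real l) / real N = of_int (2 * i) * pi"
        unfolding exp_eq_1 by auto
      hence "2 * pi * (real n - real l) = of_int (2 * i) * pi * real N"
        using N by (subst (asm) divide_eq_eq) simp
      also have "\<dots> = 2 * pi * (of_int i * real N)"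
        by simp
      finally have "real n - real l = of_int i * real N"
        by (subst (asm) mult_cancel_left) simp
      hence "of_int (int n - int l) = (of_int (i * int N) :: real)"
        by simp
      hence i: "int n - int l = i * int N"
        by (simp only: of_int_eq_iff)
      have "int N dvd int n - int l" unfolding i by simp
      moreover have "\<bar>int n - int l\<bar> < int N" "int n - int l \<noteq> 0"
        using assms False by auto
      ultimately show False
        using dvd_imp_le_int[of "int n - int l" "int N"] by simp
    qed
    ultimately show ?thesis
      unfolding eq using False by (simp add: sum_gp_strict)
  qed
qed

text \<open>
  Parseval's identity for polynomials, with the circle replaced by the \<open>N\<close>-th roots of unity.  For
  degree less than \<open>N\<close> this finite average equals the integral mean.
\<close>

lemma parseval_unity_roots:
  fixes p :: "complex poly"
  assumes "degree p < N"
  shows "(\<Sum>j<N. (cmod (poly p (cis (2 * pi * real j / real N))))\<^sup>2) =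
    real N * (\<Sum>n<N. (cmod (coeff p n))\<^sup>2)"
proof -
  let ?u = "\<lambda>j. cis (2 * pi * real j / real N)"
  have p: "poly p x = (\<Sum>n<N. coeff p n * x ^ n)" for x
  proof -
    have "poly p x = (\<Sum>n\<le>degree p. coeff p n * x ^ n)" by (rule poly_altdef)
    also have "\<dots> = (\<Sum>n<N. coeff p n * x ^ n)"
      using assms by (intro sum.mono_neutral_left) (auto simp: coeff_eq_0)
    finally show ?thesis .
  qed
  have "complex_of_real (\<Sum>j<N. (cmod (poly p (?u j)))\<^sup>2) = (\<Sum>j<N. poly p (?u j) * cnj (poly p (?u j)))"
    by (simp only: complex_norm_square of_real_sum)
  also have "\<dots> = (\<Sum>j<N. \<Sum>n<N. \<Sum>l<N. coeff p n * cnj (coeff p l) * (?u j ^ n * cnj (?u j) ^ l))"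
    by (simp add: p sum_product mult_ac)
  also have "\<dots> = (\<Sum>n<N. \<Sum>l<N. \<Sum>j<N. coeff p n * cnj (coeff p l) * (?u j ^ n * cnj (?u j) ^ l))"
    by (subst sum.swap) (intro sum.cong refl sum.swap)
  also have "\<dots> = (\<Sum>n<N. \<Sum>l<N. coeff p n * cnj (coeff p l) * (if n = l then of_nat N else 0))"
    unfolding sum_distrib_left[symmetric]
    by (intro sum.cong refl arg_cong2[where f = "(*)"] sum_unity_root_powers) auto
  also have "\<dots> = (\<Sum>n<N. coeff p n * cnj (coeff p n) * of_nat N)"
    by (intro sum.cong refl) (simp add: if_distrib cong: if_cong)
  also have "\<dots> = complex_of_real (real N * (\<Sum>n<N. (cmod (coeff p n))\<^sup>2))"
    by (simp add: complex_norm_square sum_distrib_left mult_ac del: of_real_power)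
  finally show ?thesis
    by (simp only: of_real_eq_iff)
qed

lemma hnorm_of_poly_sq:
  assumes "degree p < N"
  shows "(hnorm (fps_of_poly p))\<^sup>2 = (\<Sum>n<N. (cmod (coeff p n))\<^sup>2)"
proof -
  have "(hnorm (fps_of_poly p))\<^sup>2 = (\<Sum>n. (cmod (coeff p n))\<^sup>2)"
    by (simp add: hnorm_sq)
  also have "\<dots> = (\<Sum>n<N. (cmod (coeff p n))\<^sup>2)"
    using assms by (intro suminf_finite) (auto simp: coeff_eq_0)
  finally show ?thesis .
qed

lemma hnorm_of_poly_monom: "hnorm (fps_of_poly (monom c n)) = cmod c"
proof -
  have "(hnorm (fps_of_poly (monom c n)))\<^sup>2 = (\<Sum>i<Suc n. (cmod (coeff (monom c n) i))\<^sup>2)"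
    by (intro hnorm_of_poly_sq) (simp add: degree_monom_le le_imp_less_Suc)
  also have "\<dots> = (cmod c)\<^sup>2"
    by (simp add: if_distrib cong: if_cong)
  finally show ?thesis by (simp add: power2_eq_iff_nonneg)
qed

lemma hardy_truncation_tendsto:
  assumes "hardy f"
  shows "(\<lambda>N. hnorm (f - fps_of_poly (truncate_fps N f))) \<longlonglongrightarrow> 0"
proof -
  have eq: "hnorm (f - fps_of_poly (truncate_fps N f)) = sqrt ((hnorm f)\<^sup>2 - (\<Sum>i<N. (cmod (f $ i))\<^sup>2))" for N
  proof -
    let ?g = "f - fps_of_poly (truncate_fps N f)"
    have g: "hardy ?g" using assms by (intro hardy_diff hardy_of_poly)
    have "(hnorm ?g)\<^sup>2 = (hnorm (fps_shift N ?g))\<^sup>2"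
      using hnorm_sq_shift[OF g, of N] by (simp add: sum.neutral)
    also have "fps_shift N ?g = fps_shift N f"
      by (simp add: fps_eq_iff)
    finally show ?thesis
      by (simp add: hnorm_sq_shift[OF assms] real_sqrt_unique)
  qed
  have "(\<lambda>N. \<Sum>i<N. (cmod (f $ i))\<^sup>2) \<longlonglongrightarrow> (hnorm f)\<^sup>2"
    using summable_LIMSEQ[of "\<lambda>i. (cmod (f $ i))\<^sup>2"] assms by (simp add: hnorm_sq) (simp add: hardy_def)
  hence "(\<lambda>N. sqrt ((hnorm f)\<^sup>2 - (\<Sum>i<N. (cmod (f $ i))\<^sup>2))) \<longlonglongrightarrow> sqrt ((hnorm f)\<^sup>2 - (hnorm f)\<^sup>2)"
    by (intro tendsto_intros)
  thus ?thesis by (simp add: eq del: fps_of_poly_truncate)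
qed

lemma poly_mult_lower_bound_poly:
  assumes "\<delta> \<ge> 0" "\<And>t. cmod t = 1 \<Longrightarrow> \<delta> \<le> cmod (poly p t)"
  shows "\<delta> * hnorm (fps_of_poly q) \<le> hnorm (fps_of_poly (p * q))"
proof -
  define N where "N = Suc (max (degree q) (degree (p * q)))"
  have N: "degree q < N" "degree (p * q) < N" "N > 0" by (auto simp: N_def)
  have "real N * (\<delta> * hnorm (fps_of_poly q))\<^sup>2 =
      (\<Sum>j<N. (\<delta> * cmod (poly q (cis (2 * pi * real j / real N))))\<^sup>2)"
    by (simp add: hnorm_of_poly_sq[OF N(1)] parseval_unity_roots[OF N(1)] power_mult_distrib
        flip: sum_distrib_left)
  also have "\<dots> \<le> (\<Sum>j<N. (cmod (poly (p * q) (cis (2 * pi * real j / real N))))\<^sup>2)"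
    using assms by (intro sum_mono power_mono) (auto simp: norm_mult intro!: mult_right_mono)
  also have "\<dots> = real N * (hnorm (fps_of_poly (p * q)))\<^sup>2"
    by (simp only: hnorm_of_poly_sq[OF N(2)] parseval_unity_roots[OF N(2)])
  finally have "(\<delta> * hnorm (fps_of_poly q))\<^sup>2 \<le> (hnorm (fps_of_poly (p * q)))\<^sup>2"
    using N(3) by simp
  thus ?thesis by (rule power2_le_imp_le) simp
qed

text \<open>
  For polynomials \<open>f\<close> this is Parseval's identity; the general case follows by truncating \<open>f\<close>, since
  multiplication by \<open>p\<close> is bounded.
\<close>

lemma poly_mult_lower_bound:
  assumes "\<delta> \<ge> 0" "\<And>t. cmod t = 1 \<Longrightarrow> \<delta> \<le> cmod (poly p t)" "hardy f"
  shows "\<delta> * hnorm f \<le> hnorm (fps_of_poly p * f)"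
proof -
  obtain K where K: "K \<ge> 0" "\<And>f. hardy f \<Longrightarrow> hnorm (fps_of_poly p * f) \<le> K * hnorm f"
    using poly_mult_bounded by blast
  define e where "e N = hnorm (f - fps_of_poly (truncate_fps N f))" for N
  have e: "e \<longlonglongrightarrow> 0"
    unfolding e_def by (rule hardy_truncation_tendsto) fact
  have "\<delta> * (hnorm f - e N) \<le> hnorm (fps_of_poly p * f) + K * e N" for N
  proof -
    let ?q = "fps_of_poly (truncate_fps N f)"
    have h: "hardy (f - ?q)" using assms by blast
    have "hnorm f - e N \<le> hnorm ?q"
      using hnorm_triangle[OF h hardy_of_poly, of "truncate_fps N f"] by (simp add: e_def del: fps_of_poly_truncate)
    hence "\<delta> * (hnorm f - e N) \<le> \<delta> * hnorm ?q"
      using assms(1) by (rule mult_left_mono)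
    also have "\<dots> \<le> hnorm (fps_of_poly p * ?q)"
      using poly_mult_lower_bound_poly[OF assms(1,2), of "truncate_fps N f"] by (simp add: fps_of_poly_mult)
    also have "\<dots> \<le> hnorm (fps_of_poly p * f) + hnorm (fps_of_poly p * (f - ?q))"
      using hnorm_diff_ge[of "fps_of_poly p * ?q" "fps_of_poly p * f"] assms(3)
        hnorm_minus_commute[of "fps_of_poly p * ?q" "fps_of_poly p * f"]
      by (simp add: hardy_poly_mult right_diff_distrib del: fps_of_poly_truncate)
    also have "hnorm (fps_of_poly p * (f - ?q)) \<le> K * e N"
      unfolding e_def by (intro K h)
    finally show ?thesis by simp
  qed
  moreover have "(\<lambda>N. \<delta> * (hnorm f - e N)) \<longlonglongrightarrow> \<delta> * (hnorm f - 0)"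
    by (intro tendsto_intros e)
  moreover have "(\<lambda>N. hnorm (fps_of_poly p * f) + K * e N) \<longlonglongrightarrow> hnorm (fps_of_poly p * f) + K * 0"
    by (intro tendsto_intros e)
  ultimately show ?thesis
    using LIMSEQ_le by fastforce
qed

text \<open>
  On the unit circle \<open>1 - t * cnj z\<close> is \<open>t\<close> times the conjugate of \<open>t - z\<close>.
\<close>

lemma cmod_rev_root_poly:
  assumes "cmod t = 1"
  shows "cmod (poly (rev_root_poly (map cnj zs)) t) = cmod (poly (root_poly zs) t)"
proof (induction zs)
  case (Cons z zs)
  have "cmod (1 - t * cnj z) = cmod (t * cnj (t - z))"
    using assms complex_norm_square[of t] by (simp add: algebra_simps)
  also have "\<dots> = cmod (t - z)"
    using assms by (simp add: norm_mult del: complex_cnj_diff)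
  finally show ?case
    using Cons by (simp add: norm_mult poly_root_poly del: mult_pCons_left)
qed simp

text \<open>
  The upper triangular counterpart of \<open>poly_mult_lower_bound\<close>.  The adjoint of \<open>back_prod zs\<close> is
  multiplication by a polynomial \<open>q\<close> whose modulus on the circle is that of \<open>root_poly zs\<close>.  As all
  entries of \<open>zs\<close> lie in the open disc, \<open>q h = f\<close> has a solution with \<open>\<delta> \<parallel>h\<parallel> \<le> \<parallel>f\<parallel>\<close>, and
  \<open>\<parallel>f\<parallel>\<^sup>2 = \<langle>q h, f\<rangle> = \<langle>h, back_prod zs f\<rangle>\<close> gives the bound by the Cauchy--Schwarz inequality.
\<close>

lemma back_prod_lower_bound_circle:
  assumes "\<delta> \<ge> 0" "\<And>t. cmod t = 1 \<Longrightarrow> \<delta> \<le> cmod (poly (root_poly zs) t)"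
    and zs: "\<And>z. z \<in> set zs \<Longrightarrow> cmod z < 1" and f: "hardy f"
  shows "\<delta> * hnorm f \<le> hnorm (back_prod zs f)"
proof -
  have "\<exists>h. hardy h \<and> fps_of_poly (rev_root_poly (map cnj zs)) * h = f"
    by (rule rev_root_poly_solvable) (use zs f in auto)
  then obtain h where h: "hardy h" "fps_of_poly (rev_root_poly (map cnj zs)) * h = f"
    by blast
  have "\<delta> * hnorm h \<le> hnorm f"
    using poly_mult_lower_bound[OF assms(1) _ h(1), of "rev_root_poly (map cnj zs)"] assms(2)
    by (simp add: cmod_rev_root_poly h(2))
  have "(hnorm f)\<^sup>2 = ell2_of f \<bullet> ell2_of f"
    by (simp add: hnorm_def power2_norm_eq_inner)
  also have "\<dots> = ell2_of h \<bullet> ell2_of (back_prod zs f)"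
    using back_prod_adjoint[OF h(1) f, of zs] h(2) by simp
  also have "\<dots> \<le> hnorm h * hnorm (back_prod zs f)"
    unfolding hnorm_def by (rule norm_cauchy_schwarz)
  finally have "\<delta> * (hnorm f)\<^sup>2 \<le> \<delta> * hnorm h * hnorm (back_prod zs f)"
    using assms(1) by (simp add: mult_left_mono mult.assoc)
  also have "\<dots> \<le> hnorm f * hnorm (back_prod zs f)"
    using \<open>\<delta> * hnorm h \<le> hnorm f\<close> by (simp add: mult_right_mono)
  finally have "hnorm f * (\<delta> * hnorm f) \<le> hnorm f * hnorm (back_prod zs f)"
    by (simp add: power2_eq_square mult_ac)
  thus ?thesis
    by (cases "hnorm f = 0") (auto simp: mult_le_cancel_left order_less_le)
qed

section \<open>Toeplitz operators with Laurent polynomial symbols\<close>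

lemma coeff_symbol_poly:
  assumes "laurent_polynomial m k b"
  shows "coeff (symbol_poly m k b w) i = b (int i - int m) - (if i = m then w else 0)"
proof -
  have "(\<Sum>j = - int m..int k. coeff (monom (b j) (nat (j + int m))) i) =
      (\<Sum>j = - int m..int k. if j = int i - int m then b (int i - int m) else 0)"
    by (intro sum.cong refl) (auto simp: nat_add_distrib)
  also have "\<dots> = b (int i - int m)"
    using assms by (auto simp: sum.delta laurent_polynomial_def)
  finally show ?thesis
    by (simp add: symbol_poly_def coeff_sum)
qed

lemma degree_symbol_poly:
  assumes "laurent_polynomial m k b"
  shows "degree (symbol_poly m k b w) = m + k"
proof (rule antisym)
  show "degree (symbol_poly m k b w) \<le> m + k"
    using assms by (intro degree_le) (auto simp: coeff_symbol_poly[OF assms] laurent_polynomial_def)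
  show "m + k \<le> degree (symbol_poly m k b w)"
    using assms by (intro le_degree) (auto simp: coeff_symbol_poly[OF assms] laurent_polynomial_def)
qed

lemma symbol_poly_root_nonzero:
  assumes "laurent_polynomial m k b" "poly (symbol_poly m k b w) z = 0"
  shows "z \<noteq> 0"
proof
  assume "z = 0"
  hence "coeff (symbol_poly m k b w) 0 = 0"
    using assms(2) by (simp add: poly_0_coeff_0)
  thus False
    using assms(1) by (simp add: coeff_symbol_poly laurent_polynomial_def split: if_splits)
qed

lemma in_roots_Z_iff:
  assumes "laurent_polynomial m k b"
  shows "z \<in># roots_Z m k b w \<longleftrightarrow> z \<noteq> 0 \<and> laurent_eval m k b z = w"
proof -
  have "degree (symbol_poly m k b w) \<noteq> 0"
    using assms by (simp add: degree_symbol_poly) (simp add: laurent_polynomial_def)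
  hence "symbol_poly m k b w \<noteq> 0" by auto
  thus ?thesis
    using symbol_poly_root_nonzero[OF assms, of w z] poly_symbol_poly[of z m k b w]
    by (cases "z = 0") (auto simp: roots_Z_def)
qed

text \<open>
  The dictionary between operators and polynomials: \<open>T_b - w\<close> is multiplication by \<open>z^m (b(z) - w)\<close>
  followed by \<open>m\<close> backward shifts.
\<close>

lemma series_of_shifted_op:
  assumes "laurent_polynomial m k b"
  shows "series_of (shifted_op (toeplitz b) w x) = fps_shift m (fps_of_poly (symbol_poly m k b w) * series_of x)"
proof (rule fps_ext)
  fix i
  have "toeplitz_seq b (Rep_ell2 x) i = (\<Sum>j\<in>{..i + m}. b (int i - int j) * Rep_ell2 x j)"
    unfolding toeplitz_seq_def using assms
    by (intro suminf_finite) (auto simp: laurent_polynomial_def)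
  also have "\<dots> = (\<Sum>j\<in>{..i + m}. b (int j - int m) * Rep_ell2 x (i + m - j))"
    by (rule sum.reindex_bij_witness[of _ "\<lambda>j. i + m - j" "\<lambda>j. i + m - j"]) (auto simp: of_nat_diff)
  finally have T: "toeplitz_seq b (Rep_ell2 x) i = \<dots>" .
  have "(\<Sum>j\<in>{..i + m}. (if j = m then w else 0) * Rep_ell2 x (i + m - j)) =
      (\<Sum>j\<in>{..i + m}. if j = m then w * Rep_ell2 x i else 0)"
    by (intro sum.cong) auto
  also have "\<dots> = w * Rep_ell2 x i" by simp
  finally have "fps_shift m (fps_of_poly (symbol_poly m k b w) * series_of x) $ i =
      (\<Sum>j\<in>{..i + m}. b (int j - int m) * Rep_ell2 x (i + m - j)) - w * Rep_ell2 x i"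
    by (simp add: fps_mult_nth atLeast0AtMost coeff_symbol_poly[OF assms] left_diff_distrib sum_subtractf)
  thus "series_of (shifted_op (toeplitz b) w x) $ i = fps_shift m (fps_of_poly (symbol_poly m k b w) * series_of x) $ i"
    by (simp add: shifted_op_def Rep_ell2_simps Rep_toeplitz[OF assms] Rep_scaleC_ell2 T)
qed

lemma shifted_op_diff:
  assumes "laurent_polynomial m k b"
  shows "shifted_op (toeplitz b) w (x - y) = shifted_op (toeplitz b) w x - shifted_op (toeplitz b) w y"
  by (simp add: series_of_shifted_op[OF assms] series_of_diff right_diff_distrib fps_eq_iff flip: series_of_inject)

lemma linear_shifted_op:
  assumes "laurent_polynomial m k b"
  shows "linear (shifted_op (toeplitz b) w)"
proof (rule linearI)
  show "shifted_op (toeplitz b) w (x + y) = shifted_op (toeplitz b) w x + shifted_op (toeplitz b) w y" for x y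
    by (simp add: series_of_shifted_op[OF assms] series_of_add distrib_left fps_eq_iff flip: series_of_inject)
  have "p * (fps_const c * f) = fps_const c * (p * f)" for c and p f :: "complex fps"
    by (simp add: mult_ac)
  thus "shifted_op (toeplitz b) w (r *\<^sub>R x) = r *\<^sub>R shifted_op (toeplitz b) w x" for r x
    by (simp add: series_of_shifted_op[OF assms] series_of_scaleR fps_eq_iff flip: series_of_inject)
qed

lemma resolvent_setE:
  assumes "w \<in> resolvent_set T"
  obtains S K where "bounded_linear S" "\<And>x. S (shifted_op T w x) = x" "\<And>x. shifted_op T w (S x) = x"
    "K > 0" "\<And>x. norm (S x) \<le> K * norm x"
proof -
  obtain S where S: "bounded_linear S" "S \<circ> shifted_op T w = id" "shifted_op T w \<circ> S = id"
    using assms by (auto simp: resolvent_set_def spectrum_def)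
  then obtain K where "K > 0" "\<And>x. norm (S x) \<le> norm x * K"
    using bounded_linear.pos_bounded by blast
  thus ?thesis using S that[of S K] by (auto simp: fun_eq_iff mult.commute)
qed

lemma resolvent_setI:
  assumes "linear (shifted_op T w)" "c > 0" "\<And>x. c * norm x \<le> norm (shifted_op T w x)"
    and "\<And>y. \<exists>x. shifted_op T w x = y"
  shows "w \<in> resolvent_set T"
proof -
  let ?A = "shifted_op T w"
  have inj: "x = y" if "?A x = ?A y" for x y
  proof -
    have "c * norm (x - y) \<le> 0"
      using assms(3)[of "x - y"] that by (simp add: linear_diff[OF assms(1)])
    thus ?thesis
      using assms(2) by (simp add: mult_le_0_iff)
  qed
  define S where "S = inv ?A"
  have AS: "?A (S y) = y" for y
    unfolding S_def using assms(4)[of y] by (metis f_inv_into_f rangeI)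
  have SA: "S (?A x) = x" for x
    by (rule inj) (rule AS)
  have "bounded_linear S"
  proof (rule bounded_linear_intro)
    show "S (x + y) = S x + S y" for x y
      by (rule inj) (simp add: AS linear_add[OF assms(1)])
    show "S (r *\<^sub>R x) = r *\<^sub>R S x" for r x
      by (rule inj) (simp add: AS linear_cmul[OF assms(1)])
    show "norm (S x) \<le> norm x * (1 / c)" for x
      using assms(2) assms(3)[of "S x"] by (simp add: AS field_simps)
  qed
  thus ?thesis
    using AS SA by (auto simp: resolvent_set_def spectrum_def fun_eq_iff)
qed

text \<open>
  A Neumann series argument: if \<open>S\<close> inverts the operator at \<open>w\<close>, then the operator at \<open>w'\<close> is
  the one at \<open>w\<close> composed with \<open>x \<mapsto> x - (w' - w) S x\<close>.  Openness is what makes the distance to the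
  spectrum positive.
\<close>

lemma resolvent_set_open:
  assumes "laurent_polynomial m k b"
  shows "open (resolvent_set (toeplitz b))"
  unfolding open_dist
proof (intro ballI)
  fix w
  assume "w \<in> resolvent_set (toeplitz b)"
  then obtain S K where S: "bounded_linear S" "\<And>x. S (shifted_op (toeplitz b) w x) = x"
    "\<And>x. shifted_op (toeplitz b) w (S x) = x" "K > 0" "\<And>x. norm (S x) \<le> K * norm x"
    using resolvent_setE by blast
  have "w' \<in> resolvent_set (toeplitz b)" if w': "dist w' w < 1 / K" for w'
  proof -
    define q where "q = K * cmod (w' - w)"
    have q: "0 \<le> q" "q < 1"
      using S(4) w' by (auto simp: q_def dist_norm field_simps)
    define L where "L x = S (scaleC_ell2 (w' - w) x)" for x
    have scaleC_diff: "scaleC_ell2 c (x - y) = scaleC_ell2 c x - scaleC_ell2 c y" for c x y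
      by (simp add: series_of_scaleC series_of_diff right_diff_distrib flip: series_of_inject)
    have L_diff: "L (x - y) = L x - L y" for x y
      by (simp add: L_def scaleC_diff bounded_linear.linear[OF S(1), THEN linear_diff])
    have L_le: "norm (L x) \<le> q * norm x" for x
      using S(5)[of "scaleC_ell2 (w' - w) x"] by (simp add: L_def q_def norm_scaleC_ell2 mult.assoc)
    have A': "shifted_op (toeplitz b) w' x = shifted_op (toeplitz b) w (x - L x)" for x
      unfolding shifted_op_diff[OF assms] L_def S(3)
      by (simp add: shifted_op_def series_of_scaleC series_of_diff series_of_add algebra_simps flip: series_of_inject fps_const_sub)
    show ?thesis
    proof (rule resolvent_setI)
      show "linear (shifted_op (toeplitz b) w')"
        by (rule linear_shifted_op) fact
      show "(1 - q) / K > 0" using q S(4) by simp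
      show "(1 - q) / K * norm x \<le> norm (shifted_op (toeplitz b) w' x)" for x
      proof -
        have "(1 - q) * norm x \<le> norm x - norm (L x)"
          using L_le[of x] by (simp add: algebra_simps)
        also have "\<dots> \<le> norm (x - L x)"
          by (rule norm_triangle_ineq2)
        also have "\<dots> = norm (S (shifted_op (toeplitz b) w' x))"
          by (simp add: A' S(2))
        also have "\<dots> \<le> K * norm (shifted_op (toeplitz b) w' x)"
          by (rule S(5))
        finally show ?thesis using S(4) by (simp add: field_simps)
      qed
      show "\<exists>x. shifted_op (toeplitz b) w' x = y" for y
      proof -
        obtain x where "x - L x = S y"
          using perturbed_identity_surj[of L q "S y", OF L_diff L_le q] by blast
        thus ?thesis by (intro exI[of _ x]) (simp add: A' S(3))
      qed
    qed
  qed
  thus "\<exists>e>0. \<forall>w'. dist w' w < e \<longrightarrow> w' \<in> resolvent_set (toeplitz b)"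
    using S(4) by (intro exI[of _ "1 / K"]) auto
qed

section \<open>Roots of the symbol and the resolvent set\<close>

lemma symbol_poly_factorization:
  assumes "laurent_polynomial m k b"
  obtains ins outs c where "c \<noteq> 0"
    "symbol_poly m k b w = smult c (root_poly ins * root_poly outs)"
    "mset ins = Z_in m k b w" "mset outs = filter_mset (\<lambda>z. \<not> cmod z < 1) (roots_Z m k b w)"
    "length ins + length outs = m + k"
proof -
  define P where "P = symbol_poly m k b w"
  have deg: "degree P = m + k" "degree P \<noteq> 0"
    using assms by (simp_all add: degree_symbol_poly P_def) (simp add: laurent_polynomial_def)
  obtain ins where ins: "mset ins = filter_mset (\<lambda>z. cmod z < 1) (proots P)"
    using ex_mset by blast
  obtain outs where outs: "mset outs = filter_mset (\<lambda>z. \<not> cmod z < 1) (proots P)"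
    using ex_mset by blast
  have mset: "mset (ins @ outs) = proots P"
    by (simp add: ins outs)
  have "P = smult (lead_coeff P) (\<Prod>z\<in>#mset (ins @ outs). [:- z, 1:])"
    unfolding mset by (rule complex_poly_decompose_multiset[symmetric])
  hence P: "P = smult (lead_coeff P) (root_poly ins * root_poly outs)"
    by (simp only: prod_list_mset_root_poly root_poly_append)
  show ?thesis
  proof (rule that)
    show "lead_coeff P \<noteq> 0"
      using deg(2) leading_coeff_0_iff[of P] by fastforce
    show "symbol_poly m k b w = smult (lead_coeff P) (root_poly ins * root_poly outs)"
      unfolding P_def[symmetric] by (rule P)
    show "mset ins = Z_in m k b w"
      unfolding ins Z_in_def roots_Z_def P_def ..
    show "mset outs = filter_mset (\<lambda>z. \<not> cmod z < 1) (roots_Z m k b w)"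
      unfolding outs roots_Z_def P_def ..
    show "length ins + length outs = m + k"
      using arg_cong[OF mset, of size] size_proots_complex[of P] deg by simp
  qed
qed

text \<open>
  A root \<open>t\<close> on the circle gives a factor \<open>F - t\<close>, which is not bounded below: on the partial sums
  \<open>\<Sum>n\<le>N. t^(-n) X^n\<close>, of norm \<open>sqrt (N + 1)\<close>, all but the two extreme terms cancel.  The remaining
  factors are bounded, so the whole operator is not bounded below either.
\<close>

lemma resolvent_set_no_circle_root:
  assumes b: "laurent_polynomial m k b" and w: "w \<in> resolvent_set (toeplitz b)" and t: "cmod t = 1"
  shows "laurent_eval m k b t \<noteq> w"
proof
  assume "laurent_eval m k b t = w"
  moreover have "t \<noteq> 0" using t by auto
  ultimately have "poly (symbol_poly m k b w) t = 0"
    by (simp add: poly_symbol_poly)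
  then obtain q where q: "symbol_poly m k b w = [:- t, 1:] * q"
    by (auto simp: poly_eq_0_iff_dvd)
  obtain S K where S: "\<And>x. S (shifted_op (toeplitz b) w x) = x" "K > 0" "\<And>x. norm (S x) \<le> K * norm x"
    using resolvent_setE[OF w] by metis
  obtain K' where K': "K' \<ge> 0" "\<And>f. hardy f \<Longrightarrow> hnorm (fps_of_poly q * f) \<le> K' * hnorm f"
    using poly_mult_bounded by blast
  \<comment> \<open>The coefficients are powers of \<open>1 / t\<close>, written as \<open>cnj t\<close>.\<close>
  define p where "p N = (\<Sum>n\<le>N. monom (cnj t ^ n) n)" for N
  have tc: "t * cnj t = 1"
    using complex_norm_square[of t] t by simp
  have p_mult: "[:- t, 1:] * p N = monom (cnj t ^ N) (Suc N) - monom t 0" for N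
  proof (induction N)
    case 0
    show ?case by (simp add: p_def monom_0 monom_Suc)
  next
    case (Suc N)
    have *: "t * cnj t ^ Suc N = cnj t ^ N"
      using tc by (simp add: mult.assoc[symmetric])
    have "[:- t, 1:] * p (Suc N) = [:- t, 1:] * p N + [:- t, 1:] * monom (cnj t ^ Suc N) (Suc N)"
      by (simp add: p_def algebra_simps del: mult_pCons_left power_Suc)
    also have "[:- t, 1:] * monom (cnj t ^ Suc N) (Suc N) =
        monom (cnj t ^ Suc N) (Suc (Suc N)) - monom (t * cnj t ^ Suc N) (Suc N)"
      by (simp add: monom_Suc[of _ "Suc N"] smult_monom minus_monom del: power_Suc)
    finally show ?case
      unfolding * Suc by simp
  qed
  have coeff_p: "coeff (p N) i = (if i \<le> N then cnj t ^ i else 0)" for N i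
    by (simp add: p_def coeff_sum)
  have le: "real (Suc N) \<le> (2 * (K * K'))\<^sup>2" for N
  proof -
    let ?x = "ell2_of (fps_of_poly (p N))"
    have h: "hardy (fps_of_poly [:- t, 1:] * fps_of_poly (p N))" by blast
    have "hnorm (fps_of_poly [:- t, 1:] * fps_of_poly (p N)) =
        hnorm (fps_of_poly (monom (cnj t ^ N) (Suc N)) - fps_of_poly (monom t 0))"
      unfolding fps_of_poly_mult[symmetric] p_mult fps_of_poly_diff ..
    also have "\<dots> \<le> 2"
      using norm_triangle_ineq4[of "ell2_of (fps_of_poly (monom (cnj t ^ N) (Suc N)))" "ell2_of (fps_of_poly (monom t 0))"]
        hnorm_of_poly_monom[of "cnj t ^ N" "Suc N"] hnorm_of_poly_monom[of t 0] t
      by (simp only: hnorm_def ell2_of_diff hardy_of_poly norm_power complex_mod_cnj) simp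
    finally have le2: "hnorm (fps_of_poly [:- t, 1:] * fps_of_poly (p N)) \<le> 2" .
    have "hnorm (fps_of_poly (p N)) = norm (S (shifted_op (toeplitz b) w ?x))"
      by (simp add: S hnorm_def)
    also have "\<dots> \<le> K * hnorm (series_of (shifted_op (toeplitz b) w ?x))"
      using S(3) by simp
    also have "series_of (shifted_op (toeplitz b) w ?x) =
        fps_shift m (fps_of_poly q * (fps_of_poly [:- t, 1:] * fps_of_poly (p N)))"
      unfolding series_of_shifted_op[OF b] q fps_of_poly_mult series_of_ell2_of[OF hardy_of_poly] by (simp only: mult_ac)
    also have "hnorm \<dots> \<le> hnorm (fps_of_poly q * (fps_of_poly [:- t, 1:] * fps_of_poly (p N)))"
      by (rule hnorm_shift_le[OF hardy_poly_mult[OF h]])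
    also have "\<dots> \<le> K' * hnorm (fps_of_poly [:- t, 1:] * fps_of_poly (p N))"
      using h by (rule K'(2))
    also have "\<dots> \<le> K' * 2"
      using le2 K'(1) by (rule mult_left_mono)
    finally have le3: "hnorm (fps_of_poly (p N)) \<le> 2 * (K * K')"
      using S(2) by (simp add: mult_left_mono)
    have "real (Suc N) = (\<Sum>i<Suc N. (cmod (coeff (p N) i))\<^sup>2)"
      using t by (simp add: coeff_p norm_power)
    also have "\<dots> = (hnorm (fps_of_poly (p N)))\<^sup>2"
      by (rule hnorm_of_poly_sq[symmetric]) (auto simp: coeff_p intro!: degree_le le_imp_less_Suc)
    also have "\<dots> \<le> (2 * (K * K'))\<^sup>2"
      using le3 by (rule power_mono) simp
    finally show ?thesis .
  qed
  obtain N where "(2 * (K * K'))\<^sup>2 < real N"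
    using reals_Archimedean2 by blast
  thus False using le[of N] by simp
qed

text \<open>
  The only formal solution is \<open>1 / (X - z)\<close>, whose coefficients do not tend to zero.
\<close>

lemma inner_linear_factor_not_surj:
  assumes "cmod z < 1" "hardy g"
  shows "fps_of_poly [:- z, 1:] * g \<noteq> 1"
proof
  assume eq: "fps_of_poly [:- z, 1:] * g = 1"
  have step: "cmod (g $ n) \<le> cmod (g $ Suc n)" for n
  proof -
    have "g $ n = z * g $ Suc n"
      using linear_factor_mult_nth[of z g n] by (simp add: eq)
    thus ?thesis
      using assms(1) by (simp add: norm_mult mult_left_le_one_le)
  qed
  have "cmod (g $ 0) \<le> cmod (g $ n)" for n
    by (induction n) (use step order_trans in blast)+
  moreover have "(\<lambda>n. cmod (g $ n)) \<longlonglongrightarrow> 0"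
    using hardy_coeff_tendsto_0[OF assms(2)] by (rule tendsto_norm_zero)
  ultimately have "cmod (g $ 0) \<le> 0"
    by (intro LIMSEQ_le_const) auto
  moreover have "(fps_of_poly [:- z, 1:] * g) $ 0 = - z * g $ 0"
    by (simp add: fps_mult_nth_0)
  ultimately show False by (simp add: eq)
qed

text \<open>
  For \<open>z\<close> outside the closed disc, \<open>X - z\<close> is a multiple of \<open>1 - X / z\<close>, which has an inverse with
  square-summable coefficients.
\<close>

lemma outer_root_poly_inverse:
  assumes "\<And>z. z \<in> set zs \<Longrightarrow> 1 < cmod z"
  obtains f where "hardy f" "fps_of_poly (root_poly zs) * f = 1"
proof -
  have "hardy 1" using hardy_of_poly[of 1] by simp
  obtain a where a: "a \<noteq> 0" "root_poly zs = smult a (rev_root_poly (map inverse zs))"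
    using assms
  proof (induction zs arbitrary: thesis)
    case Nil
    show ?case by (rule Nil(1)[of 1]) auto
  next
    case (Cons z zs)
    obtain a where a: "a \<noteq> 0" "root_poly zs = smult a (rev_root_poly (map inverse zs))"
      using Cons.IH Cons.prems(2) by (metis list.set_intros(2))
    have z: "z \<noteq> 0" using Cons.prems(2)[of z] by auto
    hence "[:- z, 1:] = smult (- z) [:1, - inverse z:]" by simp
    hence "root_poly (z # zs) = smult (- z * a) (rev_root_poly (map inverse (z # zs)))"
      unfolding root_poly_simps list.map rev_root_poly_simps a(2) by (simp only: mult_smult_left mult_smult_right smult_smult mult.commute[of a])
    thus ?case using a z by (intro Cons.prems(1)[of "- z * a"]) auto
  qed
  have "\<exists>f. hardy f \<and> fps_of_poly (rev_root_poly (map inverse zs)) * f = 1"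
    using assms \<open>hardy 1\<close>
    by (intro rev_root_poly_solvable) (auto simp: norm_inverse intro!: inverse_less_1_iff[THEN iffD2])
  then obtain f where "hardy f" "fps_of_poly (rev_root_poly (map inverse zs)) * f = 1"
    by blast
  hence "fps_of_poly (root_poly zs) * (fps_const (inverse a) * f) = 1"
    using a(1) by (simp add: a(2) fps_of_poly_smult mult_ac)
      (simp add: mult.assoc[symmetric])
  thus ?thesis using that \<open>hardy f\<close> by blast
qed

text \<open>
  The Fredholm index of the operator is \<open>m\<close> minus the number of inner roots, and an invertible
  operator has index zero.  Concretely, with fewer than \<open>m\<close> inner roots the backward shifts
  annihilate the polynomial that remains after dividing by the outer factor.  With more than \<open>m\<close>,
  some factor \<open>F - z\<close> with \<open>|z| < 1\<close> is left over after the backward shifts are used up, and its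
  range misses the constant \<open>1\<close>.
\<close>

lemma resolvent_set_size_Z_in:
  assumes b: "laurent_polynomial m k b" and w: "w \<in> resolvent_set (toeplitz b)"
  shows "size (Z_in m k b w) = m"
proof -
  obtain ins outs c where P: "c \<noteq> 0" "symbol_poly m k b w = smult c (root_poly ins * root_poly outs)"
    and ins: "mset ins = Z_in m k b w"
    and outs: "mset outs = filter_mset (\<lambda>z. \<not> cmod z < 1) (roots_Z m k b w)"
    using symbol_poly_factorization[OF b] by metis
  have ins_lt: "cmod z < 1" if "z \<in> set ins" for z
    using that by (simp add: Z_in_def flip: set_mset_mset add: ins)
  have outs_gt: "1 < cmod z" if "z \<in> set outs" for z
  proof -
    have "z \<in># mset outs" using that by simp
    hence "z \<in># roots_Z m k b w" "\<not> cmod z < 1"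
      unfolding outs by auto
    moreover from this have "cmod z \<noteq> 1"
      using resolvent_set_no_circle_root[OF b w, of z] by (auto simp: in_roots_Z_iff[OF b])
    ultimately show ?thesis by simp
  qed
  obtain S where S: "\<And>x. S (shifted_op (toeplitz b) w x) = x" "\<And>x. shifted_op (toeplitz b) w (S x) = x"
    using resolvent_setE[OF w] by metis
  have "\<not> length ins < m"
  proof
    assume less: "length ins < m"
    obtain f where f: "hardy f" "fps_of_poly (root_poly outs) * f = 1"
      using outer_root_poly_inverse outs_gt by blast
    \<comment> \<open>What is left after the outer factor cancels has degree less than \<open>m\<close>, so the shift kills it.\<close>
    have "series_of (shifted_op (toeplitz b) w (ell2_of f)) =
        fps_shift m (fps_const c * (fps_of_poly (root_poly ins) * (fps_of_poly (root_poly outs) * f)))"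
      by (simp add: series_of_shifted_op[OF b] series_of_ell2_of f(1) P(2) fps_of_poly_smult fps_of_poly_mult mult.assoc)
    also have "\<dots> = series_of 0"
      using less by (auto simp: f(2) fps_eq_iff series_of_zero coeff_eq_0 degree_root_poly)
    also have "\<dots> = series_of (shifted_op (toeplitz b) w 0)"
      by (simp add: series_of_shifted_op[OF b] series_of_zero)
    finally have "ell2_of f = 0"
      by (metis series_of_inject S(1))
    hence "f = 0"
      using f(1) by (metis series_of_ell2_of series_of_zero)
    thus False using f(2) by simp
  qed
  moreover have "\<not> length ins > m"
  proof
    assume gt: "length ins > m"
    define us where "us = take m ins"
    define z where "z = ins ! m"
    define vs where "vs = drop (Suc m) ins"
    have eq: "ins = us @ z # vs" "length us = m"
      using gt by (auto simp: us_def z_def vs_def id_take_nth_drop)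
    have lt: "cmod z < 1" "\<And>u. u \<in> set us \<Longrightarrow> cmod u < 1"
      using ins_lt by (auto simp: eq(1))
    have h1: "hardy 1" using hardy_of_poly[of 1] by simp
    define x where "x = S (ell2_of (back_prod us 1))"
    define g where "g = fps_of_poly (smult c (root_poly vs * root_poly outs)) * series_of x"
    have g: "hardy g" by (auto simp: g_def)
    have "symbol_poly m k b w = root_poly us * ([:- z, 1:] * smult c (root_poly vs * root_poly outs))"
      by (simp only: P(2) eq(1) root_poly_append root_poly_simps mult_smult_right mult_ac)
    hence "series_of (shifted_op (toeplitz b) w x) = back_prod us (fps_of_poly [:- z, 1:] * g)"
      by (simp only: series_of_shifted_op[OF b] fps_of_poly_mult mult.assoc g_def eq(2)
          flip: fps_shift_root_poly_mult)
    moreover have "series_of (shifted_op (toeplitz b) w x) = back_prod us 1"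
      using h1 by (simp add: x_def S(2) series_of_ell2_of hardy_back_prod)
    ultimately have "back_prod us (fps_of_poly [:- z, 1:] * g) = back_prod us 1"
      by (rule trans[OF sym])
    hence "fps_of_poly [:- z, 1:] * g = 1"
      using back_prod_inject[OF hardy_poly_mult[OF g] h1, of us] lt(2) by blast
    thus False
      using inner_linear_factor_not_surj[OF lt(1) g] by blast
  qed
  ultimately have "length ins = m" by simp
  thus ?thesis
    using arg_cong[OF ins, of size] by simp
qed

section \<open>Winding numbers of the symbol curve\<close>

lemma laurent_eval_holomorphic: "laurent_eval m k b holomorphic_on - {0}"
  unfolding laurent_eval_def by (intro holomorphic_intros) auto

lemma winding_number_circlepath_0:
  assumes "s > 0" "cmod z \<noteq> s"
  shows "winding_number (circlepath 0 s) z = (if cmod z < s then 1 else 0)"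
proof (cases "cmod z < s")
  case True
  thus ?thesis by (simp add: winding_number_circlepath)
next
  case False
  have "winding_number (circlepath 0 s) z = 0"
    using assms False
    by (intro winding_number_zero_outside[of _ "cball 0 s"]) (auto simp: dist_norm)
  thus ?thesis using False by simp
qed

lemma DERIV_root_poly:
  assumes "z \<notin> set zs"
  shows "(poly (root_poly zs) has_field_derivative
           poly (root_poly zs) z * (\<Sum>\<zeta>\<leftarrow>zs. 1 / (z - \<zeta>))) (at z)"
  using assms
proof (induction zs)
  case Nil
  have "poly (root_poly []) = (\<lambda>z. 1)" by (simp add: fun_eq_iff)
  thus ?case by simp
next
  case (Cons \<zeta> zs)
  have eq: "poly (root_poly (\<zeta> # zs)) = (\<lambda>x. (x - \<zeta>) * poly (root_poly zs) x)"
    by (simp add: fun_eq_iff algebra_simps)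
  define pr where "pr = poly (root_poly zs)"
  have "(pr has_field_derivative pr z * (\<Sum>\<zeta>\<leftarrow>zs. 1 / (z - \<zeta>))) (at z)"
    using Cons by (simp add: pr_def)
  thus ?case
    unfolding eq pr_def[symmetric] using Cons.prems
    by (auto intro!: derivative_eq_intros simp: field_simps)
qed

lemma has_contour_integral_sum_list:
  assumes "\<And>x. x \<in> set xs \<Longrightarrow> (f x has_contour_integral I x) \<gamma>"
  shows "((\<lambda>z. \<Sum>x\<leftarrow>xs. f x z) has_contour_integral (\<Sum>x\<leftarrow>xs. I x)) \<gamma>"
  using assms by (induction xs) (auto intro: has_contour_integral_add has_contour_integral_0)

text \<open>
  The logarithmic derivative of \<open>b - w\<close> is \<open>\<Sum>1 / (z - \<zeta>) - m / z\<close>, the sum ranging over the roots,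
  and every summand contributes the winding number of the circle around its pole.  Circles of
  arbitrary radius are needed for symbols with the Jordan property.
\<close>

lemma winding_number_symbol_circle:
  assumes b: "laurent_polynomial m k b" and s: "s > 0"
    and w: "w \<notin> laurent_eval m k b ` sphere 0 s"
  shows "winding_number (laurent_eval m k b \<circ> circlepath 0 s) w =
    of_int (int (size (filter_mset (\<lambda>z. cmod z < s) (roots_Z m k b w))) - int m)"
proof -
  let ?f = "laurent_eval m k b" and ?\<gamma> = "circlepath 0 s"
  obtain zs c where c: "c \<noteq> 0" and P: "symbol_poly m k b w = smult c (root_poly zs)"
    and zs: "mset zs = roots_Z m k b w"
  proof -
    obtain ins outs c where *: "c \<noteq> 0"
      "symbol_poly m k b w = smult c (root_poly ins * root_poly outs)"
      "mset ins = Z_in m k b w" "mset outs = filter_mset (\<lambda>z. \<not> cmod z < 1) (roots_Z m k b w)"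
      using symbol_poly_factorization[OF b] by metis
    show ?thesis
      by (rule that[of c "ins @ outs"]) (simp_all add: * root_poly_append Z_in_def)
  qed
  have zs_set: "z \<in> set zs \<longleftrightarrow> z \<noteq> 0 \<and> ?f z = w" for z
    using in_roots_Z_iff[OF b, of z w] by (simp flip: zs)
  have off: "cmod z \<noteq> s" if "z \<in> set zs" for z
    using that w by (auto simp: zs_set)
  have path_\<gamma>: "path_image ?\<gamma> = sphere 0 s"
    using s by simp
  have f_eq: "?f z = w + c * poly (root_poly zs) z / z ^ m" if "z \<noteq> 0" for z
    using poly_symbol_poly[OF that, of m k b w] that by (simp add: P field_simps)
  have logderiv: "deriv ?f z * (1 / (?f z - w)) = (\<Sum>\<zeta>\<leftarrow>zs. 1 / (z - \<zeta>)) - of_nat m * (1 / (z - 0))"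
    if z: "z \<in> sphere 0 s" for z
  proof -
    have z0: "z \<noteq> 0" and zzs: "z \<notin> set zs"
      using z s off by auto
    define p where "p = poly (root_poly zs) z"
    define q where "q = (\<Sum>\<zeta>\<leftarrow>zs. 1 / (z - \<zeta>))"
    have p0: "p \<noteq> 0"
      using zzs by (auto simp: p_def poly_root_poly prod_list_zero_iff)
    define pr where "pr = poly (root_poly zs)"
    have "(pr has_field_derivative p * q) (at z)"
      using DERIV_root_poly[OF zzs] by (simp add: pr_def p_def q_def)
    moreover have "pr z = p"
      by (simp add: pr_def p_def)
    ultimately have "((\<lambda>z. w + c * pr z / z ^ m) has_field_derivative
        ((c * (p * q)) * z ^ m - (c * p) * (of_nat m * z ^ (m - 1))) / (z ^ m * z ^ m)) (at z)"
      using z0 by (auto intro!: derivative_eq_intros)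
    hence "(?f has_field_derivative
        ((c * (p * q)) * z ^ m - (c * p) * (of_nat m * z ^ (m - 1))) / (z ^ m * z ^ m)) (at z)"
      by (rule has_field_derivative_transform_within_open[of _ _ _ "- {0}"])
        (use z0 f_eq in \<open>auto simp: pr_def\<close>)
    hence d: "deriv ?f z = ((c * (p * q)) * z ^ m - (c * p) * (of_nat m * z ^ (m - 1))) / (z ^ m * z ^ m)"
      by (rule DERIV_imp_deriv)
    have zm: "of_nat m * z ^ (m - 1) = of_nat m * z ^ m / z"
      using z0 by (cases m) auto
    have "deriv ?f z = (c * p / z ^ m) * (q - of_nat m * (1 / z))"
      unfolding d zm using z0 by (simp add: field_simps)
    moreover have "?f z - w = c * p / z ^ m"
      using f_eq[OF z0] by (simp add: p_def)
    moreover have "c * p / z ^ m \<noteq> 0"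
      using c p0 z0 by simp
    ultimately show ?thesis
      by (simp add: q_def)
  qed
  have valid: "valid_path (?f \<circ> ?\<gamma>)"
    using s by (intro valid_path_compose_holomorphic[OF _ laurent_eval_holomorphic]) auto
  have w_path: "w \<notin> path_image (?f \<circ> ?\<gamma>)"
    using w unfolding path_image_compose path_\<gamma> .
  have int0: "((\<lambda>z. 1 / (z - \<zeta>)) has_contour_integral (2 * pi * \<i> * (if cmod \<zeta> < s then 1 else 0))) ?\<gamma>"
    if "cmod \<zeta> \<noteq> s" for \<zeta>
    using has_contour_integral_winding_number[of ?\<gamma> \<zeta>] that s
    by (simp add: winding_number_circlepath_0)
  have "((\<lambda>z. (\<Sum>\<zeta>\<leftarrow>zs. 1 / (z - \<zeta>)) - of_nat m * (1 / (z - 0))) has_contour_integral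
      (\<Sum>\<zeta>\<leftarrow>zs. 2 * pi * \<i> * (if cmod \<zeta> < s then 1 else 0)) -
        of_nat m * (2 * pi * \<i> * (if cmod 0 < s then 1 else 0))) ?\<gamma>"
    using s off
    by (intro has_contour_integral_diff has_contour_integral_lmul has_contour_integral_sum_list int0) auto
  moreover have "(\<Sum>\<zeta>\<leftarrow>zs. 2 * pi * \<i> * (if cmod \<zeta> < s then 1 else 0)) =
      2 * pi * \<i> * of_nat (size (filter_mset (\<lambda>z. cmod z < s) (mset zs)))"
    by (induction zs) (auto simp: algebra_simps)
  ultimately have int: "((\<lambda>z. (\<Sum>\<zeta>\<leftarrow>zs. 1 / (z - \<zeta>)) - of_nat m * (1 / (z - 0))) has_contour_integral
      2 * pi * \<i> * of_int (int (size (filter_mset (\<lambda>z. cmod z < s) (roots_Z m k b w))) - int m)) ?\<gamma>"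
    using s by (simp add: zs algebra_simps)
  have "winding_number (?f \<circ> ?\<gamma>) w =
      1 / (2 * pi * \<i>) * contour_integral (?f \<circ> ?\<gamma>) (\<lambda>u. 1 / (u - w))"
    by (rule winding_number_valid_path[OF valid w_path])
  also have "contour_integral (?f \<circ> ?\<gamma>) (\<lambda>u. 1 / (u - w)) =
      contour_integral ?\<gamma> (\<lambda>z. deriv ?f z * (1 / (?f z - w)))"
    using s laurent_eval_holomorphic[of m k b]
    by (intro contour_integral_comp_analyticW[of _ "- {0}"]) (auto simp: analytic_on_open open_Compl)
  also have "\<dots> = contour_integral ?\<gamma> (\<lambda>z. (\<Sum>\<zeta>\<leftarrow>zs. 1 / (z - \<zeta>)) - of_nat m * (1 / (z - 0)))"
    by (intro contour_integral_cong refl logderiv) (use path_\<gamma> in blast)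
  also have "\<dots> = 2 * pi * \<i> * of_int (int (size (filter_mset (\<lambda>z. cmod z < s) (roots_Z m k b w))) - int m)"
    using int by (rule contour_integral_unique)
  finally show ?thesis
    by (simp only: nonzero_mult_div_cancel_left times_divide_eq_left mult_1_left) simp
qed

lemma resolvent_set_subset_Omega:
  assumes "laurent_polynomial m k b"
  shows "resolvent_set (toeplitz b) \<subseteq> Omega m k b"
proof
  fix w
  assume w: "w \<in> resolvent_set (toeplitz b)"
  hence "w \<notin> laurent_eval m k b ` sphere 0 1"
    using resolvent_set_no_circle_root[OF assms w] by (metis imageE mem_sphere_0)
  thus "w \<in> Omega m k b"
    using winding_number_symbol_circle[OF assms, of 1 w] resolvent_set_size_Z_in[OF assms w]
    by (simp add: Omega_def symbol_curve_def Z_in_def)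
qed

section \<open>Lower bounds for the shifted operator\<close>

text \<open>
  Used with \<open>g\<close> and \<open>f\<close> of the form \<open>1 + |z|\<close> and \<open>\<bar>1 - |z|\<bar>\<close>, to replace a product over roots that
  move with \<open>w\<close> by a power of a constant.
\<close>

lemma power_times_prod_list_le:
  fixes f g :: "'a \<Rightarrow> real"
  assumes "q \<ge> 0" "\<And>x. x \<in> set xs \<Longrightarrow> 0 \<le> g x" "\<And>x. x \<in> set xs \<Longrightarrow> q * g x \<le> f x"
  shows "q ^ length xs * (\<Prod>x\<leftarrow>xs. g x) \<le> (\<Prod>x\<leftarrow>xs. f x)"
  using assms(2,3)
proof (induction xs)
  case (Cons x xs)
  have nn: "0 \<le> (\<Prod>x\<leftarrow>xs. g x)"
    by (rule prod_list_nonneg) (use Cons.prems(1) in auto)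
  have "q ^ length (x # xs) * (\<Prod>x\<leftarrow>x # xs. g x) = (q * g x) * (q ^ length xs * (\<Prod>x\<leftarrow>xs. g x))"
    by simp
  also have "\<dots> \<le> f x * (\<Prod>x\<leftarrow>xs. f x)"
    using Cons assms(1) nn by (intro mult_mono) (auto intro: order_trans[OF _ Cons.prems(2)])
  finally show ?case by simp
qed simp

lemma cmod_root_poly_le:
  assumes "cmod t = 1"
  shows "cmod (poly (root_poly zs) t) \<le> (\<Prod>z\<leftarrow>zs. 1 + cmod z)"
proof (induction zs)
  case (Cons z zs)
  have "cmod (t - z) \<le> 1 + cmod z"
    using norm_triangle_ineq4[of t z] assms by simp
  thus ?case
    using Cons by (simp add: poly_root_poly norm_mult mult_mono del: root_poly_simps)
qed simp

lemma prod_one_plus_cmod_pos: "(\<Prod>z\<leftarrow>zs. 1 + cmod z) > 0"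
  by (induction zs) (auto intro!: mult_pos_pos add_pos_nonneg)

text \<open>
  On the circle the outer factor has modulus \<open>|b - w| / \<Prod>|t - \<zeta>|\<close>, at least \<open>d / \<Prod>(1 + |\<zeta>|)\<close> with the
  product over the inner roots \<open>\<zeta>\<close>.  The inner factor loses at most \<open>\<Prod>(1 - |\<zeta>|)\<close>, and the quotient of
  the two products is controlled because \<open>u \<mapsto> (1 - u) / (1 + u)\<close> decreases.
\<close>

lemma shifted_op_lower_bound_inner:
  assumes b: "laurent_polynomial m k b"
    and d: "d \<ge> 0" "\<And>t. cmod t = 1 \<Longrightarrow> d \<le> cmod (laurent_eval m k b t - w)"
    and size: "size (Z_in m k b w) = m" and r: "0 < r" "r < 1" "set_mset (Z_in m k b w) \<subseteq> {z. cmod z \<le> r}"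
  shows "d * ((1 - r) / (1 + r)) ^ m * norm x \<le> norm (shifted_op (toeplitz b) w x)"
proof -
  obtain ins outs c where c: "c \<noteq> 0"
    and P: "symbol_poly m k b w = smult c (root_poly ins * root_poly outs)"
    and ins: "mset ins = Z_in m k b w"
    using symbol_poly_factorization[OF b] by metis
  have len: "length ins = m"
    using arg_cong[OF ins, of size] size by simp
  have ins_le: "cmod z \<le> r" if "z \<in> set ins" for z
    using r(3) that by (auto simp flip: ins)
  define M where "M = (\<Prod>z\<leftarrow>ins. 1 + cmod z)"
  have M: "M > 0" unfolding M_def by (rule prod_one_plus_cmod_pos)
  define g where "g = fps_of_poly (smult c (root_poly outs)) * series_of x"
  have g: "hardy g" by (auto simp: g_def)
  have "d / M * norm x \<le> hnorm g"
    unfolding g_def hnorm_series_of[symmetric]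
  proof (rule poly_mult_lower_bound)
    fix t :: complex
    assume t: "cmod t = 1"
    hence "t \<noteq> 0" by auto
    have "d \<le> cmod (poly (symbol_poly m k b w) t)"
      using d(2)[OF t] t by (simp add: poly_symbol_poly[OF \<open>t \<noteq> 0\<close>] norm_mult norm_power)
    also have "\<dots> = cmod (poly (root_poly ins) t) * cmod (poly (smult c (root_poly outs)) t)"
      by (simp add: P norm_mult)
    also have "\<dots> \<le> M * cmod (poly (smult c (root_poly outs)) t)"
      unfolding M_def by (intro mult_right_mono cmod_root_poly_le t) simp
    finally show "d / M \<le> cmod (poly (smult c (root_poly outs)) t)"
      using M by (simp add: divide_le_eq mult.commute)
  qed (use d M in auto)
  moreover have "series_of (shifted_op (toeplitz b) w x) = back_prod ins g"
    by (simp add: series_of_shifted_op[OF b] P g_def fps_of_poly_mult fps_of_poly_smult mult_ac len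
        flip: fps_shift_root_poly_mult)
  ultimately have 1: "(\<Prod>z\<leftarrow>ins. 1 - cmod z) * (d / M * norm x) \<le> norm (shifted_op (toeplitz b) w x)"
    using back_prod_lower_bound[OF g, of ins] ins_le r
    by (smt (verit, ccfv_SIG) hnorm_series_of mult_left_mono prod_list_nonneg imageE list.set_map)
  have "((1 - r) / (1 + r)) ^ length ins * M \<le> (\<Prod>z\<leftarrow>ins. 1 - cmod z)"
    unfolding M_def
  proof (rule power_times_prod_list_le)
    fix z assume "z \<in> set ins"
    hence "cmod z \<le> r" by (rule ins_le)
    thus "(1 - r) / (1 + r) * (1 + cmod z) \<le> 1 - cmod z"
      using r by (simp add: field_simps)
  qed (use r in auto)
  hence "((1 - r) / (1 + r)) ^ m * M * (d / M * norm x) \<le> (\<Prod>z\<leftarrow>ins. 1 - cmod z) * (d / M * norm x)"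
    using d M by (intro mult_right_mono) (auto simp: len)
  also note 1
  finally show ?thesis using M by (simp add: mult_ac)
qed

text \<open>
  The mirror image of the preceding lemma.  The triangle inequality is applied to the outer factor,
  and the inner factor, of modulus \<open>|b - w| / |c \<Prod>(t - \<zeta>)|\<close> with the product over the outer roots, is
  bounded below through its values on the circle.
\<close>

lemma shifted_op_lower_bound_outer:
  assumes b: "laurent_polynomial m k b"
    and d: "d \<ge> 0" "\<And>t. cmod t = 1 \<Longrightarrow> d \<le> cmod (laurent_eval m k b t - w)"
    and w: "w \<notin> laurent_eval m k b ` sphere 0 1"
    and size: "size (Z_in m k b w) = m" and R: "R > 1" "set_mset (Z_ext m k b w) \<subseteq> {z. R \<le> cmod z}"
  shows "d * ((R - 1) / (R + 1)) ^ k * norm x \<le> norm (shifted_op (toeplitz b) w x)"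
proof -
  obtain ins outs c where c: "c \<noteq> 0"
    and P: "symbol_poly m k b w = smult c (root_poly ins * root_poly outs)"
    and ins: "mset ins = Z_in m k b w"
    and outs: "mset outs = filter_mset (\<lambda>z. \<not> cmod z < 1) (roots_Z m k b w)"
    and lens: "length ins + length outs = m + k"
    using symbol_poly_factorization[OF b] by metis
  have len: "length ins = m" "length outs = k"
    using arg_cong[OF ins, of size] size lens by simp_all
  have ins_lt: "cmod z < 1" if "z \<in> set ins" for z
    using that by (simp add: Z_in_def flip: set_mset_mset add: ins)
  have outs_ge: "R \<le> cmod z" if "z \<in> set outs" for z
  proof -
    have z: "z \<in># roots_Z m k b w" "\<not> cmod z < 1"
      using that by (simp_all flip: set_mset_mset add: outs)
    moreover from this have "cmod z \<noteq> 1"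
      using w by (auto simp: in_roots_Z_iff[OF b])
    ultimately have "z \<in># Z_ext m k b w" by (simp add: Z_ext_def)
    thus ?thesis using R(2) by auto
  qed
  define M where "M = (\<Prod>z\<leftarrow>outs. 1 + cmod z)"
  have M: "M > 0" unfolding M_def by (rule prod_one_plus_cmod_pos)
  define g where "g = fps_const c * (fps_of_poly (root_poly outs) * series_of x)"
  have g: "hardy g" by (auto simp: g_def)
  have "series_of (shifted_op (toeplitz b) w x) = back_prod ins g"
    by (simp add: series_of_shifted_op[OF b] P g_def fps_of_poly_mult fps_of_poly_smult mult_ac len
        flip: fps_shift_root_poly_mult)
  moreover have "d / (cmod c * M) * hnorm g \<le> hnorm (back_prod ins g)"
  proof (rule back_prod_lower_bound_circle)
    fix t :: complex
    assume t: "cmod t = 1"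
    hence "t \<noteq> 0" by auto
    have "d \<le> cmod (poly (symbol_poly m k b w) t)"
      using d(2)[OF t] t by (simp add: poly_symbol_poly[OF \<open>t \<noteq> 0\<close>] norm_mult norm_power)
    also have "\<dots> = cmod c * cmod (poly (root_poly outs) t) * cmod (poly (root_poly ins) t)"
      by (simp add: P norm_mult)
    also have "\<dots> \<le> cmod c * M * cmod (poly (root_poly ins) t)"
      unfolding M_def by (intro mult_right_mono mult_left_mono cmod_root_poly_le t) simp_all
    finally show "d / (cmod c * M) \<le> cmod (poly (root_poly ins) t)"
      using M c by (simp add: divide_le_eq mult.commute)
  qed (use d M c g ins_lt in auto)
  ultimately have 1: "d / (cmod c * M) * hnorm g \<le> norm (shifted_op (toeplitz b) w x)"
    by (metis hnorm_series_of)
  have "((R - 1) / (R + 1)) ^ length outs * M \<le> (\<Prod>z\<leftarrow>outs. cmod z - 1)"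
    unfolding M_def
  proof (rule power_times_prod_list_le)
    fix z assume "z \<in> set outs"
    hence "R \<le> cmod z" by (rule outs_ge)
    thus "(R - 1) / (R + 1) * (1 + cmod z) \<le> cmod z - 1"
      using R by (simp add: field_simps)
  qed (use R in auto)
  hence "((R - 1) / (R + 1)) ^ k * M * norm x \<le> (\<Prod>z\<leftarrow>outs. cmod z - 1) * norm x"
    by (intro mult_right_mono) (auto simp: len)
  also have "\<dots> \<le> hnorm (fps_of_poly (root_poly outs) * series_of x)"
    using root_poly_lower_bound[OF hardy_series_of, of outs x] outs_ge R(1) by force
  finally have "cmod c * (((R - 1) / (R + 1)) ^ k * M * norm x) \<le> hnorm g"
    by (simp add: g_def hnorm_const_mult hardy_poly_mult mult_left_mono)
  hence "d / (cmod c * M) * (cmod c * (((R - 1) / (R + 1)) ^ k * M * norm x)) \<le> d / (cmod c * M) * hnorm g"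
    using d M by (intro mult_left_mono) auto
  also note 1
  finally show ?thesis using M c by (simp add: mult_ac)
qed

lemma resolvent_onorm_le:
  assumes b: "laurent_polynomial m k b" and w: "w \<in> resolvent_set (toeplitz b)"
    and c: "c > 0" "\<And>x. c * norm x \<le> norm (shifted_op (toeplitz b) w x)"
  shows "onorm (resolvent (toeplitz b) w) \<le> 1 / c"
proof (rule onorm_bound)
  fix y
  obtain S where S: "\<And>x. shifted_op (toeplitz b) w (S x) = x"
    using resolvent_setE[OF w] by metis
  have "shifted_op (toeplitz b) w (resolvent (toeplitz b) w y) = y"
    unfolding resolvent_def by (rule f_inv_into_f) (metis S rangeI)
  thus "norm (resolvent (toeplitz b) w y) \<le> 1 / c * norm y"
    using c(1) c(2)[of "resolvent (toeplitz b) w y"] by (simp add: field_simps)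
qed (use c in auto)

text \<open>
  The spectrum contains the image of the circle, so the distance \<open>D\<close> from \<open>w\<close> to the spectrum is an
  admissible value of \<open>d\<close> in the lower bounds.
\<close>

lemma regular_laurent_resolvent_bound:
  assumes "regular_laurent m k b"
  shows "\<exists>C>0. \<forall>w\<in>resolvent_set (toeplitz b).
          onorm (resolvent (toeplitz b) w) \<le> C / infdist w (spectrum (toeplitz b))"
proof -
  have b: "laurent_polynomial m k b"
    using assms by (simp add: regular_laurent_def)
  obtain q where q: "q > 0"
    and bound: "\<And>w d x. w \<in> resolvent_set (toeplitz b) \<Longrightarrow> d \<ge> 0 \<Longrightarrow>
      (\<And>t. cmod t = 1 \<Longrightarrow> d \<le> cmod (laurent_eval m k b t - w)) \<Longrightarrow>
      d * q * norm x \<le> norm (shifted_op (toeplitz b) w x)"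
  proof -
    note \<Omega> = subsetD[OF resolvent_set_subset_Omega[OF b]]
    consider (inner) r where "0 < r" "r < 1" "\<And>w. w \<in> Omega m k b \<Longrightarrow> set_mset (Z_in m k b w) \<subseteq> {z. cmod z \<le> r}"
      | (outer) R where "R > 1" "\<And>w. w \<in> Omega m k b \<Longrightarrow> set_mset (Z_ext m k b w) \<subseteq> {z. R \<le> cmod z}"
      using assms unfolding regular_laurent_def by blast
    thus ?thesis
    proof cases
      case inner
      show ?thesis
      proof (rule that)
        show "((1 - r) / (1 + r)) ^ m > 0" using inner by simp
        show "d * ((1 - r) / (1 + r)) ^ m * norm x \<le> norm (shifted_op (toeplitz b) w x)"
          if "w \<in> resolvent_set (toeplitz b)" "d \<ge> 0"
            "\<And>t. cmod t = 1 \<Longrightarrow> d \<le> cmod (laurent_eval m k b t - w)" for w d x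
          using that inner
          by (intro shifted_op_lower_bound_inner[OF b] resolvent_set_size_Z_in[OF b] inner(3) \<Omega>)
      qed
    next
      case outer
      show ?thesis
      proof (rule that)
        show "((R - 1) / (R + 1)) ^ k > 0" using outer by simp
        show "d * ((R - 1) / (R + 1)) ^ k * norm x \<le> norm (shifted_op (toeplitz b) w x)"
          if "w \<in> resolvent_set (toeplitz b)" "d \<ge> 0"
            "\<And>t. cmod t = 1 \<Longrightarrow> d \<le> cmod (laurent_eval m k b t - w)" for w d x
          using that outer \<Omega>[of w]
          by (intro shifted_op_lower_bound_outer[OF b] resolvent_set_size_Z_in[OF b] outer(2) \<Omega>)
             (auto simp: Omega_def)
      qed
    qed
  qed
  define \<sigma> where "\<sigma> = spectrum (toeplitz b)"
  have \<sigma>_compl: "resolvent_set (toeplitz b) = - \<sigma>"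
    by (simp add: resolvent_set_def \<sigma>_def)
  have circle: "laurent_eval m k b t \<in> \<sigma>" if "cmod t = 1" for t
    using resolvent_set_no_circle_root[OF b _ that] by (auto simp: \<sigma>_compl)
  have "closed \<sigma>"
    using resolvent_set_open[OF b] by (simp add: \<sigma>_compl closed_open)
  have ne: "\<sigma> \<noteq> {}"
    using circle[of 1] by auto
  show ?thesis
  proof (intro exI[of _ "1 / q"] conjI ballI)
    fix w
    assume w: "w \<in> resolvent_set (toeplitz b)"
    define D where "D = infdist w \<sigma>"
    have D: "D > 0"
      unfolding D_def using w \<open>closed \<sigma>\<close> ne by (intro infdist_pos_not_in_closed) (auto simp: \<sigma>_compl)
    have "onorm (resolvent (toeplitz b) w) \<le> 1 / (D * q)"
    proof (rule resolvent_onorm_le[OF b w])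
      show "D * q * norm x \<le> norm (shifted_op (toeplitz b) w x)" for x
      proof (rule bound[OF w])
        show "D \<le> cmod (laurent_eval m k b t - w)" if "cmod t = 1" for t
          using infdist_le[OF circle[OF that], of w] by (simp add: D_def dist_norm norm_minus_commute)
      qed (use D in simp)
    qed (use D q in simp)
    thus "onorm (resolvent (toeplitz b) w) \<le> 1 / q / infdist w (spectrum (toeplitz b))"
      by (simp add: D_def \<sigma>_def mult.commute)
  qed (use q in simp)
qed

section \<open>Symbols with the Jordan property\<close>

text \<open>
  Otherwise there are pairs of distinct points with equal values whose moduli tend to one.  By
  compactness they accumulate at a pair on the circle, whose two points coincide by injectivity
  there; but near that point the function is injective because its derivative does not vanish.
\<close>

lemma injective_near_circle:
  fixes f :: "complex \<Rightarrow> complex"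
  assumes holo: "f holomorphic_on - {0}" and inj: "inj_on f (sphere 0 1)"
    and deriv: "\<And>t. t \<in> sphere 0 1 \<Longrightarrow> deriv f t \<noteq> 0"
  obtains e where "0 < e" "e < 1" "inj_on f {z. 1 - e < cmod z \<and> cmod z < 1 + e}"
proof -
  have "\<exists>e. 0 < e \<and> e < 1 \<and> inj_on f {z. 1 - e < cmod z \<and> cmod z < 1 + e}"
  proof (rule ccontr)
    assume contr: "\<nexists>e. 0 < e \<and> e < 1 \<and> inj_on f {z. 1 - e < cmod z \<and> cmod z < 1 + e}"
    define \<epsilon> where "\<epsilon> n = inverse (real (Suc (Suc n)))" for n
    have \<epsilon>: "0 < \<epsilon> n" "\<epsilon> n < 1" for n
      by (auto simp: \<epsilon>_def field_simps)
    have \<epsilon>0: "\<epsilon> \<longlonglongrightarrow> 0"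
      unfolding \<epsilon>_def using LIMSEQ_Suc[OF LIMSEQ_inverse_real_of_nat] by simp
    have "\<exists>u v. u \<noteq> v \<and> f u = f v \<and> \<bar>cmod u - 1\<bar> < \<epsilon> n \<and> \<bar>cmod v - 1\<bar> < \<epsilon> n" for n
    proof -
      have "\<not> inj_on f {z. 1 - \<epsilon> n < cmod z \<and> cmod z < 1 + \<epsilon> n}"
        using contr \<epsilon> by blast
      then obtain u v where "u \<noteq> v" "f u = f v" "1 - \<epsilon> n < cmod u" "cmod u < 1 + \<epsilon> n"
        "1 - \<epsilon> n < cmod v" "cmod v < 1 + \<epsilon> n"
        unfolding inj_on_def by blast
      thus ?thesis by (intro exI[of _ u] exI[of _ v]) auto
    qed
    then obtain u v where uv: "\<And>n. u n \<noteq> v n" "\<And>n. f (u n) = f (v n)"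
      "\<And>n. \<bar>cmod (u n) - 1\<bar> < \<epsilon> n" "\<And>n. \<bar>cmod (v n) - 1\<bar> < \<epsilon> n"
      by metis
    have "cmod (u n) \<le> 2" "cmod (v n) \<le> 2" for n
      using uv(3,4)[of n] \<epsilon>(2)[of n] by auto
    hence bdd: "\<forall>n. (u n, v n) \<in> cball 0 2 \<times> cball 0 2" by auto
    have "seq_compact (cball 0 2 \<times> cball 0 2 :: (complex \<times> complex) set)"
      by (intro compact_imp_seq_compact compact_Times compact_cball)
    then obtain l r where r: "strict_mono (r :: nat \<Rightarrow> nat)"
      and lim: "((\<lambda>n. (u n, v n)) \<circ> r) \<longlonglongrightarrow> l"
      using seq_compactE[OF _ bdd] by blast
    obtain x y where l: "l = (x, y)" by fastforce
    have x: "(u \<circ> r) \<longlonglongrightarrow> x" and y: "(v \<circ> r) \<longlonglongrightarrow> y"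
      using tendsto_fst[OF lim] tendsto_snd[OF lim] by (simp_all add: l o_def)
    have on_circle: "cmod p = 1" if "(q \<circ> r) \<longlonglongrightarrow> p" "\<And>n. \<bar>cmod (q n) - 1\<bar> < \<epsilon> n" for p q
    proof -
      have "(\<lambda>n. cmod (q (r n)) - 1) \<longlonglongrightarrow> 0"
      proof (rule Lim_null_comparison)
        show "\<forall>\<^sub>F n in sequentially. norm (cmod (q (r n)) - 1) \<le> (\<epsilon> \<circ> r) n"
          using that(2) by (intro always_eventually allI) (auto intro: less_imp_le)
        show "(\<epsilon> \<circ> r) \<longlonglongrightarrow> 0"
          using LIMSEQ_subseq_LIMSEQ[OF \<epsilon>0 r] .
      qed
      moreover have "(\<lambda>n. cmod (q (r n)) - 1) \<longlonglongrightarrow> cmod p - 1"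
        using that(1) unfolding o_def by (intro tendsto_intros)
      ultimately show ?thesis
        using LIMSEQ_unique by fastforce
    qed
    have xy: "cmod x = 1" "cmod y = 1"
      using on_circle[OF x uv(3)] on_circle[OF y uv(4)] .
    have cont: "isCont f p" if "cmod p = 1" for p
      using holomorphic_on_imp_continuous_on[OF holo] that
      by (subst (asm) continuous_on_eq_continuous_at) auto
    have "f x = f y"
      using isCont_tendsto_compose[OF cont[OF xy(1)] x] isCont_tendsto_compose[OF cont[OF xy(2)] y]
        uv(2) LIMSEQ_unique by (simp add: o_def)
    hence "x = y"
      using inj xy by (auto simp: inj_on_def)
    obtain \<rho> where \<rho>: "\<rho> > 0" "inj_on f (ball x \<rho>)"
    proof (rule has_complex_derivative_locally_injective[OF holo])
      show "x \<in> - {0}" "deriv f x \<noteq> 0"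
        using deriv[of x] xy by auto
    qed (auto simp: open_Compl)
    have "\<forall>\<^sub>F n in sequentially. (u \<circ> r) n \<in> ball x \<rho>" "\<forall>\<^sub>F n in sequentially. (v \<circ> r) n \<in> ball x \<rho>"
      using topological_tendstoD[OF x open_ball, of x \<rho>] topological_tendstoD[OF y open_ball, of x \<rho>]
        \<rho>(1) \<open>x = y\<close> by auto
    hence "\<forall>\<^sub>F n in sequentially. (u \<circ> r) n \<in> ball x \<rho> \<and> (v \<circ> r) n \<in> ball x \<rho>"
      by (rule eventually_conj)
    then obtain n where "u (r n) \<in> ball x \<rho>" "v (r n) \<in> ball x \<rho>"
      unfolding eventually_sequentially by (metis comp_apply order_refl)
    thus False
      using \<rho>(2) uv(1,2)[of "r n"] by (auto simp: inj_on_def)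
  qed
  thus ?thesis using that by blast
qed

text \<open>
  When \<open>z\<close> moves outwards across the circle, exactly the root \<open>z\<close> of \<open>b - b(z)\<close> leaves the unit disc.
  The winding number of the curve therefore differs on the two sides and cannot vanish on both.
\<close>

lemma LJ_polynomial_imp_regular_laurent:
  assumes "LJ_polynomial m k b"
  shows "regular_laurent m k b"
proof -
  let ?f = "laurent_eval m k b"
  have b: "laurent_polynomial m k b"
    using assms by (simp add: LJ_polynomial_def)
  obtain e where e: "0 < e" "e < 1" and inj: "inj_on ?f {z. 1 - e < cmod z \<and> cmod z < 1 + e}"
  proof (rule injective_near_circle[OF laurent_eval_holomorphic])
    show "inj_on ?f (sphere 0 1)" "\<And>t. t \<in> sphere 0 1 \<Longrightarrow> deriv ?f t \<noteq> 0"
      using assms by (auto simp: LJ_polynomial_def)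
  qed
  define s where "s = 1 - e / 2"
  define R where "R = 1 + e / 2"
  define A where "A = {z. s < cmod z \<and> cmod z < R}"
  have s: "0 < s" "s < 1" and R: "1 < R"
    using e by (auto simp: s_def R_def)
  have eqD: "u = v" if "?f u = ?f v" "s \<le> cmod u" "cmod u < R" "s \<le> cmod v" "cmod v < R" for u v
    using inj_onD[OF inj that(1)] that e by (auto simp: s_def R_def)
  define W where "W = (\<lambda>w. winding_number (?f \<circ> circlepath 0 s) w)"
  define N where "N = (\<lambda>x w. size (filter_mset (\<lambda>z. cmod z < x) (roots_Z m k b w)))"
  have W_const: "W (?f z) = W (?f z')" if "z \<in> A" "z' \<in> A" for z z'
  proof -
    have "winding_number (?f \<circ> circlepath 0 s) constant_on ?f ` A"
    proof (rule winding_number_constant)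
      show "path (?f \<circ> circlepath 0 s)"
        using s by (intro valid_path_imp_path valid_path_compose_holomorphic[OF _ laurent_eval_holomorphic]) auto
      have "continuous_on A ?f"
        by (rule continuous_on_subset[OF holomorphic_on_imp_continuous_on[OF laurent_eval_holomorphic]])
           (use s in \<open>auto simp: A_def\<close>)
      moreover have "connected A"
        using connected_annulus(1)[where a = "0 :: complex" and ?r1.0 = s and ?r2.0 = R] by (simp add: A_def)
      ultimately show "connected (?f ` A)"
        by (rule connected_continuous_image)
      show "?f ` A \<inter> path_image (?f \<circ> circlepath 0 s) = {}"
        using eqD s R by (force simp: A_def path_image_compose)
    qed (simp add: pathfinish_compose pathstart_compose)
    thus ?thesis
      using that unfolding constant_on_def W_def by auto
  qed
  have W_eq: "W (?f z) = of_int (int (N s (?f z)) - int m)" if "z \<in> A" for z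
    unfolding W_def N_def
  proof (rule winding_number_symbol_circle[OF b s(1)])
    show "?f z \<notin> ?f ` sphere 0 s"
      using eqD[of z] that s R by (force simp: A_def)
  qed
  \<comment> \<open>By injectivity the image of \<open>A\<close> avoids the image of the circle of radius \<open>s\<close>, and \<open>A\<close> is connected.\<close>
  have N_const: "N s (?f z) = N s (?f z')" if "z \<in> A" "z' \<in> A" for z z'
  proof -
    have "of_int (int (N s (?f z)) - int m) = (of_int (int (N s (?f z')) - int m) :: complex)"
      using W_const[OF that] W_eq[OF that(1)] W_eq[OF that(2)] by simp
    thus ?thesis by simp
  qed
  have N_Omega: "N 1 w = m" if "w \<in> Omega m k b" for w
  proof -
    have "of_int (int (N 1 w) - int m) = (0 :: complex)"
      using that winding_number_symbol_circle[OF b, of 1 w]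
      by (simp add: Omega_def symbol_curve_def N_def)
    thus ?thesis by simp
  qed
  have inner: "N s (?f z) < N 1 (?f z)" if "z \<in> A" "cmod z < 1" for z
  proof -
    have "z \<noteq> 0" using that s by (auto simp: A_def)
    hence z: "z \<in># filter_mset (\<lambda>z. cmod z < 1) (roots_Z m k b (?f z))"
      using that by (simp add: in_roots_Z_iff[OF b])
    have "filter_mset (\<lambda>z. cmod z < s) (roots_Z m k b (?f z)) \<subset>#
        filter_mset (\<lambda>z. cmod z < 1) (roots_Z m k b (?f z))"
    proof (rule subset_mset.le_neq_trans)
      show "filter_mset (\<lambda>z. cmod z < s) (roots_Z m k b (?f z)) \<subseteq>#
          filter_mset (\<lambda>z. cmod z < 1) (roots_Z m k b (?f z))"
      proof -
        have "filter_mset (\<lambda>z. cmod z < s) (roots_Z m k b (?f z)) =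
            filter_mset (\<lambda>z. cmod z < s) (filter_mset (\<lambda>z. cmod z < 1) (roots_Z m k b (?f z)))"
          unfolding filter_filter_mset using s by (intro filter_mset_cong) auto
        thus ?thesis by simp
      qed
      have "z \<notin># filter_mset (\<lambda>z. cmod z < s) (roots_Z m k b (?f z))"
        using that by (auto simp: A_def)
      thus "filter_mset (\<lambda>z. cmod z < s) (roots_Z m k b (?f z)) \<noteq>
          filter_mset (\<lambda>z. cmod z < 1) (roots_Z m k b (?f z))"
        using z by metis
    qed
    thus ?thesis
      unfolding N_def by (rule mset_subset_size)
  qed
  have outer: "N s (?f z) = N 1 (?f z)" if "z \<in> A" "1 < cmod z" for z
  proof -
    have "cmod x < s \<longleftrightarrow> cmod x < 1" if "x \<in># roots_Z m k b (?f z)" for x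
    proof -
      have "?f x = ?f z" using that by (simp add: in_roots_Z_iff[OF b])
      thus ?thesis
        using eqD[of x z] \<open>z \<in> A\<close> \<open>1 < cmod z\<close> s R by (cases "s \<le> cmod x") (auto simp: A_def)
    qed
    hence "filter_mset (\<lambda>z. cmod z < s) (roots_Z m k b (?f z)) =
        filter_mset (\<lambda>z. cmod z < 1) (roots_Z m k b (?f z))"
      by (intro filter_mset_cong) auto
    thus ?thesis by (simp add: N_def)
  qed
  have "(\<forall>w\<in>Omega m k b. set_mset (Z_in m k b w) \<subseteq> {z. cmod z \<le> s}) \<or>
      (\<forall>w\<in>Omega m k b. set_mset (Z_ext m k b w) \<subseteq> {z. R \<le> cmod z})"
  proof (rule ccontr)
    assume "\<not> ?thesis"
    then obtain w z w' z' where w: "w \<in> Omega m k b" "z \<in># Z_in m k b w" "\<not> cmod z \<le> s"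
      and w': "w' \<in> Omega m k b" "z' \<in># Z_ext m k b w'" "\<not> R \<le> cmod z'"
      by blast
    have z: "z \<in> A" "cmod z < 1" "?f z = w"
      using w R by (auto simp: A_def Z_in_def in_roots_Z_iff[OF b])
    have z': "z' \<in> A" "1 < cmod z'" "?f z' = w'"
      using w' s by (auto simp: A_def Z_ext_def in_roots_Z_iff[OF b])
    have "N s w < N 1 w" "N s w' = N 1 w'" "N s w = N s w'"
      using inner[OF z(1,2)] outer[OF z'(1,2)] N_const[OF z(1) z'(1)] z(3) z'(3) by simp_all
    thus False
      using N_Omega[OF w(1)] N_Omega[OF w'(1)] by simp
  qed
  thus ?thesis
    unfolding regular_laurent_def using b s R by blast
qed

theorem theorem2p1:
  fixes m k :: nat and b :: "int \<Rightarrow> complex"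
  shows
    "(regular_laurent m k b \<longrightarrow>
       (\<exists>C>0. \<forall>w\<in>resolvent_set (toeplitz b).
          onorm (resolvent (toeplitz b) w) \<le> C / infdist w (spectrum (toeplitz b)))) \<and>
     (LJ_polynomial m k b \<longrightarrow>
       (\<exists>C>0. \<forall>w\<in>resolvent_set (toeplitz b).
          onorm (resolvent (toeplitz b) w) \<le> C / infdist w (spectrum (toeplitz b))))"
  using regular_laurent_resolvent_bound LJ_polynomial_imp_regular_laurent by blast

end
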